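(* Suppose that $p>3$ is a prime, $x\in\mathbb Z_p$ and $(x+3)(1+9x+27x^2)(1+9x)(1+27x^2)(1-27x^2)\not\equiv 0\pmod p$. Then $$\Big(\sum_{k=0}^{p-1}W_kx^k\Big)^2\equiv\sum_{k=0}^{p-1}\binom{2k}k\left(\frac{x(1+9x+27x^2)}{(1-27x^2)^2}\right)^kW_k\pmod p.$$
   Context: For each nonnegative integer $n$, $W_n=\sum_{k=0}^{[n/3]}\binom{2k}k\binom{3k}k\binom n{3k}(-3)^{n-3k}$, where $[x]$ is the greatest integer not exceeding $x$. $\mathbb Z_p$ denotes the set of rational numbers whose denominator is not divisible by $p$; congruences modulo $p$ are taken in this ring. *)

theory Defs
  imports Complex_Main "HOL-Computational_Algebra.Primes"
begin

definition W :: "nat \<Rightarrow> int" where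
  "W n = (\<Sum>k = 0..n div 3. int ((2 * k) choose k) * int ((3 * k) choose k)
            * int (n choose (3 * k)) * (-3) ^ (n - 3 * k))"

text \<open>The ring of rational numbers whose denominator in lowest terms
  (the second component of \<^const>\<open>quotient_of\<close>) is not divisible by \<open>p\<close>.\<close>

definition p_integral :: "nat \<Rightarrow> rat set" where
  "p_integral p = {x. \<not> int p dvd snd (quotient_of x)}"

text \<open>Congruence in this ring: the difference lies in the ideal generated by \<open>p\<close>.
  The library congruence \<open>cong\<close> is of no use on \<^typ>\<open>rat\<close>, which is a field.\<close>

definition p_cong :: "nat \<Rightarrow> rat \<Rightarrow> rat \<Rightarrow> bool" where
  "p_cong p a b \<longleftrightarrow> (\<exists>c \<in> p_integral p. a - b = of_nat p * c)"

end

theory Submission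
  imports
    Defs
    "HOL-Computational_Algebra.Computational_Algebra"
    "HOL-Number_Theory.Cong"
begin

text \<open>
  Over the integers, with \<open>U(X) = \<Sum> W\<^sub>n X\<^sup>n\<close>, \<open>V(z) = \<Sum> binomial(2n,n) W\<^sub>n z\<^sup>n\<close> and
  \<open>z = X(1 + 9X + 27X\<^sup>2) / (1 - 27X\<^sup>2)\<^sup>2\<close>, one has \<open>U\<^sup>2 = V(z) / (1 - 27X\<^sup>2)\<close>: both sides solve
  the symmetric square of the second-order equation of \<open>U\<close>, whose only exponent at the origin
  is \<open>0\<close>. That equation comes from the hypergeometric one for \<open>C(t) = \<Sum> (3k)!/k!\<^sup>3 t\<^sup>k\<close> through
  \<open>U = J C((XJ)\<^sup>3)\<close>, \<open>J = 1/(1 + 3X)\<close>. The coefficients of \<open>U\<close> and \<open>V\<close> satisfy Lucas congruences, so modulo \<open>p\<close> the series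
  factor as \<open>U(X) = F(X) U(X\<^sup>p)\<close> and \<open>V(z) = G(z) V(z\<^sup>p)\<close> with \<open>F\<close>, \<open>G\<close> the truncations at
  degree \<open>p\<close>. Dividing the identity by its own Frobenius twist gives
  \<open>F\<^sup>2 = (1 - 27X\<^sup>2)\<^sup>p\<^sup>-\<^sup>1 G(z)\<close> modulo \<open>p\<close>. The right-hand side is a polynomial because
  \<open>binomial(2n,n)\<close> vanishes modulo \<open>p\<close> for \<open>p/2 < n < p\<close>, and the prefactor is \<open>1\<close> at a
  point where \<open>1 - 27X\<^sup>2\<close> is a unit, by Fermat.
\<close>

subsection \<open>Congruences and Frobenius for integer power series\<close>

definition fps_cong :: "nat \<Rightarrow> int fps \<Rightarrow> int fps \<Rightarrow> bool" where
  "fps_cong p f g \<longleftrightarrow> (\<forall>n. [f $ n = g $ n] (mod int p))"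

lemma fps_cong_refl [simp]: "fps_cong p f f"
  by (simp add: fps_cong_def)

lemma fps_cong_sym: "fps_cong p f g \<Longrightarrow> fps_cong p g f"
  by (simp add: fps_cong_def cong_sym)

lemma fps_cong_trans [trans]: "fps_cong p f g \<Longrightarrow> fps_cong p g h \<Longrightarrow> fps_cong p f h"
  unfolding fps_cong_def by (meson cong_trans)

lemma fps_cong_add: "fps_cong p f g \<Longrightarrow> fps_cong p f' g' \<Longrightarrow> fps_cong p (f + f') (g + g')"
  by (simp add: fps_cong_def cong_add)

lemma fps_cong_diff: "fps_cong p f g \<Longrightarrow> fps_cong p f' g' \<Longrightarrow> fps_cong p (f - f') (g - g')"
  by (simp add: fps_cong_def cong_diff)

lemma fps_cong_mult: "fps_cong p f g \<Longrightarrow> fps_cong p f' g' \<Longrightarrow> fps_cong p (f * f') (g * g')"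
  by (auto simp: fps_cong_def fps_mult_nth intro!: cong_sum cong_mult)

lemma fps_cong_power: "fps_cong p f g \<Longrightarrow> fps_cong p (f ^ n) (g ^ n)"
  by (induction n) (auto intro: fps_cong_mult)

lemma fps_cong_sum: "(\<And>i. i \<in> S \<Longrightarrow> fps_cong p (f i) (g i)) \<Longrightarrow> fps_cong p (sum f S) (sum g S)"
  by (auto simp: fps_cong_def fps_sum_nth intro!: cong_sum)

lemma fps_cong_compose:
  "fps_cong p f f' \<Longrightarrow> fps_cong p g g' \<Longrightarrow> fps_cong p (f oo g) (f' oo g')"
  using fps_cong_power[of p g g']
  by (auto simp: fps_cong_def fps_compose_nth intro!: cong_sum cong_mult)

text \<open>A series with constant term 1 is invertible over the integers.\<close>

lemma fps_cong_cancel: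
  assumes "fps_cong p (f * u) (g * u)" and "u $ 0 = 1"
  shows "fps_cong p f g"
proof -
  have u: "u * fps_right_inverse u 1 = 1"
    by (rule fps_right_inverse) (use assms(2) in simp)
  have "fps_cong p (f * u * fps_right_inverse u 1) (g * u * fps_right_inverse u 1)"
    by (rule fps_cong_mult[OF assms(1) fps_cong_refl])
  moreover have "h * u * fps_right_inverse u 1 = h" for h
    by (simp only: mult.assoc u mult_1_right)
  ultimately show ?thesis by (simp only:)
qed

text \<open>The inner coefficients \<open>binomial(p,k)\<close>, \<open>0 < k < p\<close>, are
  divisible by \<open>p\<close>. The setting is a general commutative ring so that power series are
  covered.\<close>

lemma prime_dvd_add_power_diff:
  fixes a b :: "'a :: comm_ring_1"
  assumes "prime p"
  shows "of_nat p dvd (a + b) ^ p - (a ^ p + b ^ p)"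
proof -
  have p: "p > 0" using assms prime_gt_0_nat by blast
  have "(a + b) ^ p = (\<Sum>k\<le>p. of_nat (p choose k) * a ^ k * b ^ (p - k))"
    by (rule binomial_ring)
  also have "\<dots> = (\<Sum>k\<in>{0, p}. of_nat (p choose k) * a ^ k * b ^ (p - k))
      + (\<Sum>k\<in>{..p} - {0, p}. of_nat (p choose k) * a ^ k * b ^ (p - k))"
    by (subst sum.subset_diff[of "{0, p}"]) (auto simp: add.commute)
  also have "(\<Sum>k\<in>{0, p}. of_nat (p choose k) * a ^ k * b ^ (p - k)) = a ^ p + b ^ p"
    using p by simp
  finally have "(a + b) ^ p - (a ^ p + b ^ p)
      = (\<Sum>k\<in>{..p} - {0, p}. of_nat (p choose k) * a ^ k * b ^ (p - k))" by simp
  moreover have "of_nat p dvd (\<Sum>k\<in>{..p} - {0, p}. of_nat (p choose k) * a ^ k * b ^ (p - k))"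
  proof (rule dvd_sum)
    fix k assume "k \<in> {..p} - {0, p}"
    then have "p dvd p choose k" using dvd_choose_prime[of k p] assms by auto
    then have "(of_nat p :: 'a) dvd of_nat (p choose k)"
      by (metis dvd_def of_nat_mult)
    then show "of_nat p dvd of_nat (p choose k) * a ^ k * b ^ (p - k)" by simp
  qed
  ultimately show ?thesis by simp
qed

lemma fps_cong_freshman:
  assumes "prime p"
  shows "fps_cong p ((f + g) ^ p) (f ^ p + g ^ p)"
proof -
  obtain h where "(f + g) ^ p - (f ^ p + g ^ p) = of_nat p * h"
    using prime_dvd_add_power_diff[OF assms, of f g] by (elim dvdE)
  then have "((f + g) ^ p) $ n - (f ^ p + g ^ p) $ n = int p * h $ n" for n
    by (metis fps_sub_nth fps_mult_left_const_nth fps_of_nat)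
  then show ?thesis unfolding fps_cong_def cong_iff_dvd_diff by (metis dvd_triv_left)
qed

text \<open>The Frobenius congruence \<open>f(X)^p = f(X^p)\<close> modulo \<open>p\<close>. It is
  propagated through ring operations and inverses, which reaches the rational functions
  \<open>AX\<close>, \<open>DX\<close> and \<open>zX\<close>.\<close>

definition frob :: "nat \<Rightarrow> int fps \<Rightarrow> bool" where
  "frob p f \<longleftrightarrow> fps_cong p (f ^ p) (f oo fps_X ^ p)"

lemma frob_add: "prime p \<Longrightarrow> frob p f \<Longrightarrow> frob p g \<Longrightarrow> frob p (f + g)"
  unfolding frob_def fps_compose_add_distrib
  using fps_cong_trans fps_cong_add fps_cong_freshman by blast

text \<open>Applying the binomial congruence to \<open>(f - g) + g\<close> avoids the sign of
  \<open>(-1)^p\<close>, so \<open>p = 2\<close> is no exception.\<close>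

lemma frob_diff:
  assumes "prime p" "frob p f" "frob p g"
  shows "frob p (f - g)"
proof -
  have "fps_cong p (((f - g) + g) ^ p - g ^ p) (((f - g) ^ p + g ^ p) - g ^ p)"
    using assms(1) by (intro fps_cong_diff fps_cong_freshman) auto
  then have "fps_cong p ((f - g) ^ p) (f ^ p - g ^ p)" by (simp add: fps_cong_sym)
  also have "fps_cong p (f ^ p - g ^ p) ((f oo fps_X ^ p) - (g oo fps_X ^ p))"
    using assms by (intro fps_cong_diff) (auto simp: frob_def)
  finally show ?thesis by (simp add: frob_def fps_compose_sub_distrib)
qed

lemma frob_mult:
  assumes "prime p" "frob p f" "frob p g"
  shows "frob p (f * g)"
proof -
  have "(fps_X ^ p :: int fps) $ 0 = 0" using prime_gt_0_nat[OF assms(1)] by simp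
  then show ?thesis using assms unfolding frob_def
    by (simp add: power_mult_distrib fps_compose_mult_distrib fps_cong_mult)
qed

lemma frob_1 [simp]: "frob p 1"
  by (simp add: frob_def)

lemma frob_of_nat: "prime p \<Longrightarrow> frob p (of_nat n)"
proof (induction n)
  case 0
  then show ?case using prime_gt_0_nat[of p] by (simp add: frob_def power_0_left)
qed (simp add: frob_add)

lemma frob_numeral: "prime p \<Longrightarrow> frob p (numeral k)"
  using frob_of_nat[of p "numeral k"] by simp

lemma frob_fps_X: "prime p \<Longrightarrow> frob p fps_X"
  using prime_gt_0_nat[of p] by (simp add: frob_def)

lemma frob_power: "prime p \<Longrightarrow> frob p f \<Longrightarrow> frob p (f ^ n)"
  by (induction n) (auto intro: frob_mult)

text \<open>Modulo \<open>p\<close>,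
  \<open>g^p = g^p f(X^p) g(X^p) = g^p f^p g(X^p) = g(X^p)\<close>.\<close>

lemma frob_inverse:
  assumes "prime p" "frob p f" "f * g = 1"
  shows "frob p g"
proof -
  have X: "(fps_X ^ p :: int fps) $ 0 = 0" using prime_gt_0_nat[OF assms(1)] by simp
  have g: "(f oo fps_X ^ p) * (g oo fps_X ^ p) = 1"
    using assms(3) X by (metis fps_compose_1 fps_compose_mult_distrib)
  have "fps_cong p (g ^ p * (f oo fps_X ^ p) * (g oo fps_X ^ p)) (g ^ p * f ^ p * (g oo fps_X ^ p))"
    using assms(2) by (intro fps_cong_mult) (auto simp: frob_def fps_cong_sym)
  moreover have "g ^ p * f ^ p = 1"
    using assms(3) by (simp flip: power_mult_distrib add: mult.commute)
  ultimately show ?thesis by (simp add: frob_def mult.assoc g)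
qed

text \<open>Fermat's little theorem, read off from the constant coefficient of the Frobenius
  congruence for a constant series, at the nonnegative residue of \<open>a\<close>.\<close>

lemma int_power_prime_cong:
  assumes "prime p"
  shows "[(a :: int) ^ p = a] (mod int p)"
proof -
  have *: "[of_nat n ^ p = (of_nat n :: int)] (mod int p)" for n
    using frob_of_nat[OF assms, of n]
    by (auto simp: frob_def fps_cong_def fps_of_nat[symmetric] fps_const_power dest: spec[of _ 0])
  have "[(int (nat (a mod int p))) ^ p = int (nat (a mod int p))] (mod int p)" by (rule *)
  moreover have "int (nat (a mod int p)) = a mod int p"
    using prime_gt_0_nat[OF assms] by simp
  ultimately show ?thesis by (simp add: cong_def power_mod)
qed

subsection \<open>Lucas congruences\<close>

text \<open>Since \<open>g\<close> has degree below \<open>p\<close> and \<open>h(X^p)\<close> lives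
  on multiples of \<open>p\<close>, division with remainder leaves a single term of the
  convolution.\<close>

lemma fps_mult_compose_X_power_nth:
  fixes g h :: "int fps"
  assumes "b < p" and "\<And>j. j \<ge> p \<Longrightarrow> g $ j = 0"
  shows "(g * (h oo fps_X ^ p)) $ (a * p + b) = h $ a * g $ b"
proof -
  let ?n = "a * p + b"
  have p: "p > 0" using assms by simp
  have h: "(h oo fps_X ^ p) $ m = (if p dvd m then h $ (m div p) else 0)" for m
  proof -
    have "(h oo fps_X ^ p) $ m = (\<Sum>i = 0..m. if m = p * i then h $ i else 0)"
      unfolding fps_compose_nth power_mult[symmetric] fps_X_power_nth
      by (intro sum.cong) auto
    also have "\<dots> = (\<Sum>i = 0..m. if i = m div p \<and> p dvd m then h $ i else 0)"
      using p by (intro sum.cong) auto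
    also have "\<dots> = (if p dvd m then h $ (m div p) else 0)"
      using p by (cases "p dvd m") auto
    finally show ?thesis .
  qed
  have "(g * (h oo fps_X ^ p)) $ ?n = (\<Sum>i = 0..?n. g $ i * (h oo fps_X ^ p) $ (?n - i))"
    by (simp add: fps_mult_nth)
  also have "\<dots> = (\<Sum>i = 0..?n. if i = b then h $ a * g $ b else 0)"
  proof (intro sum.cong refl)
    fix i assume i: "i \<in> {0..?n}"
    show "g $ i * (h oo fps_X ^ p) $ (?n - i) = (if i = b then h $ a * g $ b else 0)"
    proof (cases "i < p \<and> p dvd (?n - i)")
      case True
      then obtain c where "?n - i = p * c" by blast
      then have c: "a * p + b = c * p + i" using i by (simp add: mult.commute)
      then have "(a * p + b) mod p = (c * p + i) mod p" by simp
      then have "i = b" using True assms(1) by simp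
      then show ?thesis using p by (simp add: h)
    next
      case False
      have "i \<noteq> b" using False assms(1) by auto
      then show ?thesis using False assms(2)[of i] by (auto simp: h)
    qed
  qed
  also have "\<dots> = h $ a * g $ b" by simp
  finally show ?thesis .
qed

lemma fps_one_plus_X_power_nth: "((1 + fps_X) ^ n :: int fps) $ k = int (n choose k)"
proof (induction n arbitrary: k)
  case 0
  then show ?case by (cases k) auto
next
  case (Suc n)
  then show ?case by (cases k) (auto simp: distrib_right)
qed

text \<open>Compare coefficients in \<open>(1 + X)^(a p + b) = (1 + X)^b (1 + X^p)^a\<close> modulo
  \<open>p\<close>.\<close>

lemma lucas_binomial:
  assumes "prime p" "b < p" "d < p"
  shows "[int ((a * p + b) choose (c * p + d)) = int (a choose c) * int (b choose d)] (mod int p)"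
proof -
  have X: "(fps_X ^ p :: int fps) $ 0 = 0" using assms by simp
  have "fps_cong p (((1 + fps_X) ^ p) ^ a) ((1 + fps_X oo fps_X ^ p) ^ a)"
    using frob_add[OF assms(1) frob_1 frob_fps_X[OF assms(1)]]
    by (intro fps_cong_power) (simp add: frob_def)
  then have "fps_cong p ((1 + fps_X) ^ b * ((1 + fps_X) ^ p) ^ a)
      ((1 + fps_X) ^ b * ((1 + fps_X) ^ a oo fps_X ^ p))"
    by (intro fps_cong_mult) (auto simp: fps_compose_power[OF X])
  moreover have "(1 + fps_X) ^ b * ((1 + fps_X) ^ p) ^ a = (1 + fps_X :: int fps) ^ (a * p + b)"
    by (simp only: power_add power_mult[symmetric] mult.commute)
  moreover have "((1 + fps_X) ^ b * ((1 + fps_X) ^ a oo fps_X ^ p)) $ (c * p + d)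
      = int (a choose c) * int (b choose d)"
    using assms by (subst fps_mult_compose_X_power_nth) (auto simp: fps_one_plus_X_power_nth)
  ultimately show ?thesis
    unfolding fps_cong_def by (metis fps_one_plus_X_power_nth)
qed

definition lucas_seq :: "nat \<Rightarrow> (nat \<Rightarrow> int) \<Rightarrow> bool" where
  "lucas_seq p f \<longleftrightarrow> (\<forall>a b. b < p \<longrightarrow> [f (a * p + b) = f a * f b] (mod int p))"

text \<open>Position \<open>a p + b\<close> of the product reads \<open>f a * f b\<close>; this is
  how the digit rule becomes a factorization of generating functions.\<close>

lemma lucas_seq_fps_cong:
  assumes "lucas_seq p f" and "p > 0"
  shows "fps_cong p (Abs_fps f) (fps_cutoff p (Abs_fps f) * (Abs_fps f oo fps_X ^ p))"
  unfolding fps_cong_def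
proof
  fix n
  have "(fps_cutoff p (Abs_fps f) * (Abs_fps f oo fps_X ^ p)) $ (n div p * p + n mod p)
      = f (n div p) * f (n mod p)"
    using assms(2) by (subst fps_mult_compose_X_power_nth) auto
  moreover have "[f (n div p * p + n mod p) = f (n div p) * f (n mod p)] (mod int p)"
    using assms unfolding lucas_seq_def by (metis mod_less_divisor)
  ultimately show "[Abs_fps f $ n = (fps_cutoff p (Abs_fps f) * (Abs_fps f oo fps_X ^ p)) $ n] (mod int p)"
    by simp
qed

text \<open>If \<open>2 b < p\<close>, doubling causes no carry and the binomial rule applies digit
  by digit. If \<open>2 b \<ge> p\<close>, the carry leaves the low digit
  \<open>2 b - p < b\<close>, whose binomial coefficient is 0.\<close>

lemma lucas_central:
  assumes "prime p" "b < p"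
  shows "[int ((2 * (a * p + b)) choose (a * p + b))
      = int ((2 * a) choose a) * int ((2 * b) choose b)] (mod int p)"
    and "2 * b \<ge> p \<Longrightarrow> [int ((2 * b) choose b) = 0] (mod int p)"
proof -
  have big: "[int ((2 * (a * p + b)) choose (a * p + b)) = 0] (mod int p)" if "2 * b \<ge> p" for a
  proof -
    have e: "2 * (a * p + b) = (2 * a + 1) * p + (2 * b - p)"
      using that by (simp add: algebra_simps)
    moreover have "(2 * b - p) choose b = 0"
      using assms that by (intro binomial_eq_0) linarith
    moreover have "2 * b - p < p" using assms that by linarith
    note lucas_binomial[OF assms(1) this assms(2), of "2 * a + 1" a]
    ultimately show ?thesis unfolding e by (simp only: of_nat_0 mult_zero_right)
  qed
  show z: "[int ((2 * b) choose b) = 0] (mod int p)" if "2 * b \<ge> p"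
    using big[OF that, of 0] by simp
  show "[int ((2 * (a * p + b)) choose (a * p + b))
      = int ((2 * a) choose a) * int ((2 * b) choose b)] (mod int p)"
  proof (cases "2 * b \<ge> p")
    case True
    have "[int ((2 * a) choose a) * int ((2 * b) choose b) = int ((2 * a) choose a) * 0] (mod int p)"
      using z[OF True] by (intro cong_mult) auto
    then show ?thesis using big[OF True, of a] by (metis cong_trans cong_sym mult_zero_right)
  next
    case False
    have e: "2 * (a * p + b) = (2 * a) * p + 2 * b" by simp
    show ?thesis unfolding e
      using False by (intro lucas_binomial assms) linarith
  qed
qed

text \<open>The multinomial coefficient \<open>(3k)! / k!^3\<close>, factored to suit digitwise
  arguments.\<close>

definition c3 :: "nat \<Rightarrow> int" where
  "c3 k = int ((2 * k) choose k) * int ((3 * k) choose k)"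

text \<open>For \<open>2 b \<ge> p\<close> the factor \<open>binomial(2k,k)\<close> vanishes modulo
  \<open>p\<close>. For \<open>2 b < p \<le> 3 b\<close>, tripling carries exactly one and leaves
  the low digit \<open>3 b - p < b\<close>. Otherwise there is no carry.\<close>

lemma lucas_c3:
  assumes "prime p" "b < p"
  shows "[c3 (a * p + b) = c3 a * c3 b] (mod int p)"
    and "3 * b \<ge> p \<Longrightarrow> [c3 b = 0] (mod int p)"
proof -
  have big: "[c3 (a * p + b) = 0] (mod int p)" if "3 * b \<ge> p" for a
  proof (cases "2 * b \<ge> p")
    case True
    have "[int ((2 * a) choose a) * int ((2 * b) choose b) = int ((2 * a) choose a) * 0] (mod int p)"
      using lucas_central(2)[OF assms True] by (intro cong_mult) auto
    then have "[int ((2 * (a * p + b)) choose (a * p + b)) = 0] (mod int p)"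
      using lucas_central(1)[OF assms, of a] by (metis cong_trans mult_zero_right)
    then show ?thesis unfolding c3_def by (simp add: cong_0_iff)
  next
    case False
    have e: "3 * (a * p + b) = (3 * a + 1) * p + (3 * b - p)"
      using that by (simp add: algebra_simps)
    moreover have "(3 * b - p) choose b = 0"
      using False assms that by (intro binomial_eq_0) linarith
    moreover have "3 * b - p < p" using False assms that by linarith
    note lucas_binomial[OF assms(1) this assms(2), of "3 * a + 1" a]
    ultimately have "[int ((3 * (a * p + b)) choose (a * p + b)) = 0] (mod int p)"
      unfolding e by (simp only: of_nat_0 mult_zero_right)
    then show ?thesis unfolding c3_def by (simp add: cong_0_iff)
  qed
  show z: "[c3 b = 0] (mod int p)" if "3 * b \<ge> p"
    using big[OF that, of 0] by simp
  show "[c3 (a * p + b) = c3 a * c3 b] (mod int p)"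
  proof (cases "3 * b \<ge> p")
    case True
    then show ?thesis using big[OF True, of a] z[OF True]
      by (metis cong_0_iff cong_sym cong_trans dvd_mult)
  next
    case False
    have e: "3 * (a * p + b) = (3 * a) * p + 3 * b" by simp
    have "[int ((3 * (a * p + b)) choose (a * p + b))
        = int ((3 * a) choose a) * int ((3 * b) choose b)] (mod int p)"
      unfolding e using False by (intro lucas_binomial assms) linarith
    from cong_mult[OF lucas_central(1)[OF assms, of a] this]
    show ?thesis unfolding c3_def by (simp add: mult_ac)
  qed
qed

text \<open>The extra terms contain \<open>binomial(n,3k) = 0\<close>; a free upper bound lets the
  range be matched to the digits.\<close>

lemma W_eq_sum:
  assumes "n div 3 < m"
  shows "W n = (\<Sum>k<m. c3 k * int (n choose (3 * k)) * (-3) ^ (n - 3 * k))"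
  unfolding W_def c3_def
  by (rule sum.mono_neutral_left) (use assms in \<open>auto simp: binomial_eq_0\<close>)

text \<open>With \<open>k = c p + d\<close> the summand factors modulo \<open>p\<close> into one for
  \<open>a\<close> and one for \<open>b\<close>, so the sum over all \<open>(c, d)\<close> is a
  product. When \<open>3 d \<ge> p\<close> both sides vanish through \<open>c3\<close>; otherwise
  \<open>3 k\<close> has low digit \<open>3 d\<close> and high part \<open>3 c\<close>.\<close>

lemma lucas_W:
  assumes "prime p"
  shows "lucas_seq p W"
  unfolding lucas_seq_def
proof (intro allI impI)
  fix a b assume b: "b < p"
  define t where "t = (\<lambda>n k. c3 k * int (n choose (3 * k)) * (-3) ^ (n - 3 * k))"
  have t: "[t (a * p + b) (c * p + d) = t a c * t b d] (mod int p)" if d: "d < p" for c d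
  proof (cases "3 * d \<ge> p")
    case True
    have "int p dvd c3 d" using lucas_c3(2)[OF assms d True] by (simp add: cong_0_iff)
    moreover from this have "int p dvd c3 (c * p + d)"
      using lucas_c3(1)[OF assms d, of c] by (metis cong_dvd_iff dvd_mult)
    ultimately have "int p dvd t a c * t b d" "int p dvd t (a * p + b) (c * p + d)"
      unfolding t_def by auto
    then show ?thesis by (metis cong_0_iff cong_sym cong_trans)
  next
    case False
    have e: "3 * (c * p + d) = (3 * c) * p + 3 * d" by simp
    have bin: "[int ((a * p + b) choose (3 * (c * p + d)))
        = int (a choose (3 * c)) * int (b choose (3 * d))] (mod int p)"
      unfolding e using lucas_binomial[OF assms b, of "3 * d" a "3 * c"] False by simp
    show ?thesis
    proof (cases "3 * c \<le> a \<and> 3 * d \<le> b")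
      case True
      \<comment> \<open>The truncated exponent splits along the digits because neither difference is
        cut off. In the remaining case one of the digit binomials is 0 and both sides vanish modulo
        \<open>p\<close>.\<close>
      then have "a * p + b - 3 * (c * p + d) = p * (a - 3 * c) + (b - 3 * d)"
        by (auto simp: e le_iff_add algebra_simps)
      then have "(-3 :: int) ^ (a * p + b - 3 * (c * p + d))
          = ((-3) ^ p) ^ (a - 3 * c) * (-3) ^ (b - 3 * d)"
        by (simp add: power_add power_mult)
      moreover have "[((-3 :: int) ^ p) ^ (a - 3 * c) * (-3) ^ (b - 3 * d)
          = (-3) ^ (a - 3 * c) * (-3) ^ (b - 3 * d)] (mod int p)"
        by (intro cong_mult cong_pow int_power_prime_cong assms cong_refl)
      ultimately have "[(-3 :: int) ^ (a * p + b - 3 * (c * p + d))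
          = (-3) ^ (a - 3 * c) * (-3) ^ (b - 3 * d)] (mod int p)" by simp
      from cong_mult[OF cong_mult[OF lucas_c3(1)[OF assms d, of c] bin] this]
      show ?thesis unfolding t_def by (simp only: mult_ac)
    next
      case False
      then have z: "(a choose (3 * c)) * (b choose (3 * d)) = 0" by (auto simp: binomial_eq_0)
      then have "int (a choose (3 * c)) * int (b choose (3 * d)) = 0" by (metis of_nat_0 of_nat_mult)
      then have "int p dvd int ((a * p + b) choose (3 * (c * p + d)))" 
 
        using bin by (simp only: cong_0_iff)
      then have "int p dvd t (a * p + b) (c * p + d)" unfolding t_def by (intro dvd_mult2 dvd_mult)
      moreover have "t a c * t b d = 0" unfolding t_def using z by auto
      ultimately show ?thesis by (simp only: cong_0_iff)
    qed
  qed
  \<comment> \<open>Extending the range of \<open>k\<close> to \<open>(a + 1) p\<close> lets it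
    split into complete blocks of length \<open>p\<close>.\<close>
  have "(a * p + b) div 3 < Suc a * p"
  proof -
    have "(a * p + b) div 3 \<le> a * p + b" by simp
    also have "\<dots> < Suc a * p" using b by simp
    finally show ?thesis .
  qed
  then have "W (a * p + b) = (\<Sum>k<Suc a * p. t (a * p + b) k)"
    unfolding t_def by (rule W_eq_sum)
  also have "\<dots> = (\<Sum>c<Suc a. \<Sum>k = c * p..<c * p + p. t (a * p + b) k)"
    by (rule sum.nat_group[symmetric])
  also have "\<dots> = (\<Sum>c<Suc a. \<Sum>d<p. t (a * p + b) (c * p + d))"
  proof (rule sum.cong[OF refl])
    fix c
    show "(\<Sum>k = c * p..<c * p + p. t (a * p + b) k) = (\<Sum>d<p. t (a * p + b) (c * p + d))"
      using sum.shift_bounds_nat_ivl[of "t (a * p + b)" 0 "c * p" p]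
      by (simp add: atLeast0LessThan add.commute)
  qed
  finally have "[W (a * p + b) = (\<Sum>c<Suc a. \<Sum>d<p. t a c * t b d)] (mod int p)"
    by (simp only:) (intro cong_sum t, simp)
  also have "(\<Sum>c<Suc a. \<Sum>d<p. t a c * t b d) = (\<Sum>c<Suc a. t a c) * (\<Sum>d<p. t b d)"
    by (simp only: sum_product)
  also have "(\<Sum>c<Suc a. t a c) = W a"
    unfolding t_def by (rule W_eq_sum[symmetric]) simp
  also have "(\<Sum>d<p. t b d) = W b"
    unfolding t_def by (rule W_eq_sum[symmetric]) (use b in auto)
  finally show "[W (a * p + b) = W a * W b] (mod int p)" .
qed

lemma lucas_V:
  assumes "prime p"
  shows "lucas_seq p (\<lambda>n. int ((2 * n) choose n) * W n)"
  unfolding lucas_seq_def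
proof (intro allI impI)
  fix a b assume b: "b < p"
  have "[W (a * p + b) = W a * W b] (mod int p)" using lucas_W[OF assms] b by (simp add: lucas_seq_def)
  from cong_mult[OF lucas_central(1)[OF assms b, of a] this]
  show "[int ((2 * (a * p + b)) choose (a * p + b)) * W (a * p + b)
      = int ((2 * a) choose a) * W a * (int ((2 * b) choose b) * W b)] (mod int p)"
    by (simp only: mult_ac)
qed

subsection \<open>Differential equations\<close>

lemma fps_XD_mult: "fps_XD (a * b) = fps_XD a * b + a * fps_XD (b :: 'a :: comm_ring_1 fps)"
  by (simp add: fps_XD_def algebra_simps)

lemma fps_XD_diff: "fps_XD (a - b) = fps_XD a - fps_XD (b :: 'a :: comm_ring_1 fps)"
  by (simp add: fps_XD_def algebra_simps)

lemma fps_XD_uminus: "fps_XD (- a) = - fps_XD (a :: 'a :: comm_ring_1 fps)"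
  by (simp add: fps_XD_def)

lemma fps_XD_numeral [simp]: "fps_XD (numeral k :: 'a :: comm_ring_1 fps) = 0"
  by (simp add: fps_XD_def flip: numeral_fps_const)

lemma fps_XD_1 [simp]: "fps_XD (1 :: 'a :: comm_ring_1 fps) = 0"
  by (simp add: fps_XD_def)

lemma fps_XD_fps_X [simp]: "fps_XD (fps_X :: 'a :: comm_ring_1 fps) = fps_X"
  by (simp add: fps_XD_def)

lemma fps_XD_power2: "fps_XD (a ^ 2) = 2 * a * fps_XD (a :: 'a :: comm_ring_1 fps)"
  by (simp add: power2_eq_square fps_XD_mult algebra_simps)

lemma fps_XD_power3: "fps_XD (a ^ 3) = 3 * a ^ 2 * fps_XD (a :: 'a :: comm_ring_1 fps)"
  by (simp add: power2_eq_square power3_eq_cube fps_XD_mult algebra_simps)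

text \<open>Chain rule in logarithmic form: \<open>w / g\<close> plays the role of
  \<open>X b' / b\<close>, with the denominator kept on the left.\<close>

lemma fps_XD_compose:
  fixes a :: "'a :: idom fps"
  assumes "b $ 0 = 0" and "g * fps_XD b = b * w"
  shows "g * fps_XD (a oo b) = (fps_XD a oo b) * w"
proof -
  have "g * fps_XD (a oo b) = (fps_deriv a oo b) * (g * fps_XD b)"
    using assms(1) by (simp add: fps_XD_def fps_compose_deriv algebra_simps)
  also have "\<dots> = (fps_XD a oo b) * w"
    using assms by (simp add: fps_XD_def fps_compose_mult_distrib algebra_simps)
  finally show ?thesis .
qed

text \<open>As \<open>b\<close> has no constant term, \<open>b^k\<close> starts at degree
  \<open>k\<close> or later; so the inner sum may run up to \<open>n\<close> and the summations may
  be exchanged.\<close>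

lemma fps_mult_compose_nth:
  fixes a b g :: "'a :: comm_ring_1 fps"
  assumes "b $ 0 = 0"
  shows "(g * (a oo b)) $ n = (\<Sum>k = 0..n. a $ k * (g * b ^ k) $ n)"
proof -
  have "(g * (a oo b)) $ n = (\<Sum>i = 0..n. g $ i * (\<Sum>k = 0..n - i. a $ k * (b ^ k) $ (n - i)))"
    by (simp add: fps_mult_nth fps_compose_nth)
  also have "\<dots> = (\<Sum>i = 0..n. g $ i * (\<Sum>k = 0..n. a $ k * (b ^ k) $ (n - i)))"
  proof (intro sum.cong refl)
    fix i assume "i \<in> {0..n}"
    have "(\<Sum>k = 0..n - i. a $ k * (b ^ k) $ (n - i)) = (\<Sum>k = 0..n. a $ k * (b ^ k) $ (n - i))"
      using startsby_zero_power_prefix[OF assms] by (intro sum.mono_neutral_left) auto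
    then show "g $ i * (\<Sum>k = 0..n - i. a $ k * (b ^ k) $ (n - i))
        = g $ i * (\<Sum>k = 0..n. a $ k * (b ^ k) $ (n - i))" by simp
  qed
  also have "\<dots> = (\<Sum>k = 0..n. \<Sum>i = 0..n. a $ k * (g $ i * (b ^ k) $ (n - i)))"
    by (simp add: sum_distrib_left mult_ac) (rule sum.swap)
  also have "\<dots> = (\<Sum>k = 0..n. a $ k * (g * b ^ k) $ n)"
    by (simp add: fps_mult_nth sum_distrib_left)
  finally show ?thesis .
qed

section \<open>From the hypergeometric series to the second-order equation for
  \<open>W_fps\<close>\<close>

definition C3_fps :: "int fps" where "C3_fps = Abs_fps c3"
definition W_fps :: "int fps" where "W_fps = Abs_fps W"
definition V_fps :: "int fps" where "V_fps = Abs_fps (\<lambda>n. int ((2 * n) choose n) * W n)"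
definition J_fps :: "int fps" where "J_fps = Abs_fps (\<lambda>n. (-3) ^ n)"

lemma J_fps_inverse: "(1 + 3 * fps_X) * J_fps = 1"
proof (rule fps_ext)
  fix n show "((1 + 3 * fps_X) * J_fps) $ n = (1 :: int fps) $ n"
    by (cases n) (auto simp: J_fps_def distrib_right mult.assoc numeral_fps_const)
qed

lemma c3_fact: "c3 k * fact k ^ 3 = fact (3 * k)"
proof -
  have "fact k * fact k * ((2 * k) choose k) = (fact (2 * k) :: nat)"
    using binomial_fact_lemma[of k "2 * k"] by simp
  moreover have "fact k * fact (2 * k) * ((3 * k) choose k) = (fact (3 * k) :: nat)"
    using binomial_fact_lemma[of k "3 * k"] by simp
  ultimately have "((2 * k) choose k) * ((3 * k) choose k) * fact k ^ 3 = (fact (3 * k) :: nat)"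
    by (simp add: power3_eq_cube mult_ac) (metis mult.assoc mult.commute)
  then have "int (((2 * k) choose k) * ((3 * k) choose k) * fact k ^ 3) = int (fact (3 * k))"
    by simp
  then show ?thesis unfolding c3_def by simp
qed

text \<open>The ratio of consecutive terms \<open>(3n)! / n!^3\<close> is
  \<open>(3n+3)(3n+2)(3n+1) / (n+1)^3\<close>; one factor \<open>n + 1\<close> cancels against
  \<open>3n + 3\<close>.\<close>

lemma c3_Suc: "int (Suc n) ^ 2 * c3 (Suc n) = 3 * (3 * int n + 1) * (3 * int n + 2) * c3 n"
proof -
  have e: "3 * Suc n = Suc (Suc (Suc (3 * n)))" by simp
  have "c3 (Suc n) * (int (Suc n) ^ 3 * fact n ^ 3) = fact (3 * Suc n)"
    using c3_fact[of "Suc n"] by (simp only: fact_Suc of_nat_mult power_mult_distrib of_nat_id)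
  also have "\<dots> = (3 * int n + 3) * (3 * int n + 2) * (3 * int n + 1) * fact (3 * n)"
    unfolding e by (simp add: algebra_simps)
  also have "\<dots> = (3 * int n + 3) * (3 * int n + 2) * (3 * int n + 1) * (c3 n * fact n ^ 3)"
    by (simp only: c3_fact)
  finally have "int (Suc n) ^ 2 * c3 (Suc n) * (int (Suc n) * fact n ^ 3) =
      3 * (3 * int n + 1) * (3 * int n + 2) * c3 n * (int (Suc n) * fact n ^ 3)"
    by (simp add: algebra_simps power2_eq_square power3_eq_cube)
  then show ?thesis by simp
qed

text \<open>With \<open>\<theta>\<close> for \<open>fps_XD\<close> this is
  \<open>\<theta>^2 C = 3 t (3\<theta> + 1)(3\<theta> + 2) C\<close>, the recurrence
  \<open>c3_Suc\<close> read coefficientwise.\<close>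

lemma C3_fps_ode:
  "fps_XD (fps_XD C3_fps) = fps_X * (27 * fps_XD (fps_XD C3_fps) + 27 * fps_XD C3_fps + 6 * C3_fps)"
proof (rule fps_ext)
  fix n
  show "fps_XD (fps_XD C3_fps) $ n
      = (fps_X * (27 * fps_XD (fps_XD C3_fps) + 27 * fps_XD C3_fps + 6 * C3_fps)) $ n"
  proof (cases n)
    case (Suc m)
    then show ?thesis
      using c3_Suc[of m]
      by (simp add: C3_fps_def numeral_fps_const algebra_simps power2_eq_square)
  qed simp
qed

text \<open>Expansion of \<open>X^m / (1 + 3X)^(m+1)\<close>. Multiplying the claimed series by
  \<open>1 + 3X\<close> and using Pascal's rule gives the step from \<open>m\<close> to
  \<open>m + 1\<close>.\<close>

lemma J_fps_power_nth: "(fps_X ^ m * J_fps ^ Suc m) $ n = int (n choose m) * (-3) ^ (n - m)"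
proof -
  define K where "K = (\<lambda>m. Abs_fps (\<lambda>n. int (n choose m) * (-3) ^ (n - m)))"
  have step: "K (Suc m) = fps_X * J_fps * K m" for m
  proof -
    have "(1 + 3 * fps_X) * K (Suc m) = fps_X * K m"
    proof (rule fps_ext)
      fix n show "((1 + 3 * fps_X) * K (Suc m)) $ n = (fps_X * K m) $ n"
      proof (cases n)
        case (Suc l)
        show ?thesis
        proof (cases "l \<ge> Suc m")
          case True
          then have "l - m = Suc (l - Suc m)" by simp
          then show ?thesis using Suc
            by (simp add: K_def distrib_right mult.assoc numeral_fps_const algebra_simps)
        next
          case False
          then show ?thesis using Suc
            by (simp add: K_def distrib_right mult.assoc numeral_fps_const binomial_eq_0)
        qed
      qed (simp add: K_def)
    qed
    then show ?thesis using J_fps_inverse by algebra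
  qed
  have "K m = fps_X ^ m * J_fps ^ Suc m"
  proof (induction m)
    case 0
    show ?case by (simp add: K_def J_fps_def)
  next
    case (Suc m)
    then show ?case by (simp add: step algebra_simps)
  qed
  then show ?thesis by (simp add: K_def fps_eq_iff)
qed

text \<open>In \<open>W n\<close>, the factor next to \<open>c3 k\<close> is the coefficient of
  \<open>X^n\<close> in \<open>X^(3k) J^(3k+1)\<close>.\<close>

lemma W_fps_eq: "W_fps = J_fps * (C3_fps oo (fps_X * J_fps) ^ 3)"
proof (rule fps_ext)
  fix n
  have "(J_fps * (C3_fps oo (fps_X * J_fps) ^ 3)) $ n
      = (\<Sum>k = 0..n. c3 k * (fps_X ^ (3 * k) * J_fps ^ Suc (3 * k)) $ n)"
    by (subst fps_mult_compose_nth)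
       (simp_all add: C3_fps_def power_mult_distrib power_mult[symmetric] mult_ac)
  also have "\<dots> = (\<Sum>k = 0..n. c3 k * int (n choose (3 * k)) * (-3) ^ (n - 3 * k))"
    unfolding J_fps_power_nth by (simp add: mult.assoc)
  also have "\<dots> = (\<Sum>k = 0..n div 3. c3 k * int (n choose (3 * k)) * (-3) ^ (n - 3 * k))"
    by (rule sum.mono_neutral_right) (auto simp: not_le binomial_eq_0)
  also have "\<dots> = W_fps $ n"
    by (simp add: W_fps_def W_def c3_def)
  finally show "W_fps $ n = (J_fps * (C3_fps oo (fps_X * J_fps) ^ 3)) $ n" ..
qed

text \<open>\<open>AX = (1 + 3X)^3 - 27 X^3\<close> is the factor \<open>1 - 27 t\<close> of the
  hypergeometric equation at \<open>t = (X J)^3\<close>, cleared of \<open>J^3\<close>.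
  \<open>CX\<close> is the right-hand factor of the resulting self-adjoint equation.\<close>

definition AX :: "int fps" where "AX = 1 + 9 * fps_X + 27 * fps_X ^ 2"
definition CX :: "int fps" where "CX = - 3 * fps_X - 27 * fps_X ^ 2"

lemma XD_AX: "fps_XD AX = 9 * fps_X + 54 * fps_X ^ 2"
  by (simp add: AX_def fps_XD_mult fps_XD_power2 power2_eq_square)

lemma XD_CX: "fps_XD CX = - 3 * fps_X - 54 * fps_X ^ 2"
  by (simp add: CX_def fps_XD_mult fps_XD_power2 fps_XD_diff fps_XD_uminus power2_eq_square)

text \<open>Pull the hypergeometric equation back along \<open>s = (X J)^3\<close>. As
  \<open>\<theta>s = 3 J s\<close>, differentiating a series composed with \<open>s\<close> only
  brings in a factor \<open>3 J\<close>.\<close>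

lemma W_fps_ode: "fps_XD (AX * fps_XD W_fps) = CX * W_fps"
proof -
  let ?X = "fps_X :: int fps" and ?J = J_fps
  define s where "s = (?X * ?J) ^ 3"
  define H0 where "H0 = C3_fps oo s"
  define H1 where "H1 = fps_XD C3_fps oo s"
  define H2 where "H2 = fps_XD (fps_XD C3_fps) oo s"
  have J1: "(1 + 3 * ?X) * ?J = 1" by (rule J_fps_inverse)
  have "fps_XD ((1 + 3 * ?X) * ?J) = 0" unfolding J1 by simp
  then have "3 * ?X * ?J + (1 + 3 * ?X) * fps_XD ?J = 0"
    by (simp add: fps_XD_mult)
  then have XJ: "fps_XD ?J = - 3 * ?X * ?J ^ 2" using J1 by algebra
  have s0: "s $ 0 = 0" by (simp add: s_def power_mult_distrib)
  have "fps_XD s = 3 * (?X * ?J) ^ 2 * (?X * ?J - 3 * ?X ^ 2 * ?J ^ 2)"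
    unfolding s_def fps_XD_power3 fps_XD_mult XJ fps_XD_fps_X by algebra
  also have "\<dots> = s * (3 * ?J)" using J1 unfolding s_def by algebra
  finally have Xs: "fps_XD s = s * (3 * ?J)" .
  have XH0: "fps_XD H0 = H1 * (3 * ?J)" and XH1: "fps_XD H1 = H2 * (3 * ?J)"
    unfolding H0_def H1_def H2_def 
    using fps_XD_compose[OF s0, of 1] Xs by simp_all
  have H2: "H2 = s * (27 * H2 + 27 * H1 + 6 * H0)"
    unfolding H0_def H1_def H2_def
    by (subst C3_fps_ode) (simp add: fps_compose_mult_distrib fps_compose_add_distrib s0)
  have AJ: "AX * ?J ^ 3 = 1 - 27 * s"
    using J1 unfolding s_def AX_def by algebra
  have W: "W_fps = ?J * H0" unfolding W_fps_eq H0_def s_def ..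
  have XW: "fps_XD W_fps = 3 * ?J ^ 2 * (H1 - ?X * H0)"
    by (simp add: W fps_XD_mult XJ XH0 algebra_simps power2_eq_square)
  have "fps_XD (AX * fps_XD W_fps) = (9 * ?X + 54 * ?X ^ 2) * (3 * ?J ^ 2 * (H1 - ?X * H0))
      + AX * (6 * ?J * (- 3 * ?X * ?J ^ 2) * (H1 - ?X * H0)
        + 3 * ?J ^ 2 * (3 * ?J * H2 - ?X * H0 - 3 * ?X * ?J * H1))"
    unfolding XW by (simp add: fps_XD_mult fps_XD_power2 fps_XD_diff XJ XH0 XH1 XD_AX algebra_simps)
  also have "\<dots> = CX * (?J * H0)"
  proof -
    \<comment> \<open>\<open>AX J^3 = 1 - 27 s\<close> is the leading coefficient of the
      hypergeometric equation at \<open>s\<close>, so that equation eliminates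
      \<open>H2\<close>.\<close>
    have "9 * AX * ?J ^ 3 * H2 = 9 * (27 * s * H1 + 6 * s * H0)"
      using AJ H2 by algebra
    then show ?thesis using J1 unfolding s_def AX_def CX_def by algebra
  qed
  finally show ?thesis unfolding W .
qed

section \<open>Recurrences and the third-order equation for \<open>V_fps\<close>\<close>

lemma W_rec:
  "int (Suc (Suc n)) ^ 2 * W (Suc (Suc n)) =
     - (9 * int (Suc (Suc n)) * int (Suc n) + 3) * W (Suc n) - 27 * int (Suc n) ^ 2 * W n"
proof -
  let ?X = "fps_X :: int fps"
  \<comment> \<open>Multiplications by \<open>X\<close> are nested so that each becomes an index
    shift when coefficients are read off.\<close>
  have "AX * fps_XD W_fps = fps_XD W_fps + 9 * (?X * fps_XD W_fps) + 27 * (?X * (?X * fps_XD W_fps))"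
    unfolding AX_def by algebra
  moreover have "CX * W_fps = - (3 * (?X * W_fps)) - 27 * (?X * (?X * W_fps))"
    unfolding CX_def by algebra
  ultimately have "(fps_XD (fps_XD W_fps + 9 * (?X * fps_XD W_fps) + 27 * (?X * (?X * fps_XD W_fps)))) $ Suc (Suc n)
      = (- (3 * (?X * W_fps)) - 27 * (?X * (?X * W_fps))) $ Suc (Suc n)"
    using W_fps_ode by simp
  then have "(int n + 2) * ((int n + 2) * W (Suc (Suc n)) + 9 * ((int n + 1) * W (Suc n)) + 27 * (int n * W n))
      = - 3 * W (Suc n) - 27 * W n"
    by (simp del: fps_XD_add add: W_fps_def numeral_fps_const algebra_simps)
  then show ?thesis by (simp add: algebra_simps power2_eq_square)
qed

text \<open>Multiply \<open>W_rec\<close> by \<open>(n+2) binomial(2n+4,n+2)\<close> and lower the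
  central binomials by \<open>(k+1) binomial(2k+2,k+1) = 2 (2k+1) binomial(2k,k)\<close>.\<close>

lemma V_rec:
  fixes n :: nat
  defines "v \<equiv> \<lambda>k. int ((2 * k) choose k) * W k"
  shows "int (Suc (Suc n)) ^ 3 * v (Suc (Suc n)) =
     - 2 * (2 * int n + 3) * (9 * int (Suc (Suc n)) * int (Suc n) + 3) * v (Suc n)
     - 108 * (2 * int n + 3) * (2 * int n + 1) * int (Suc n) * v n"
proof -
  have b: "int (Suc k) * int ((2 * Suc k) choose Suc k) = 2 * (2 * int k + 1) * int ((2 * k) choose k)" for k
  proof -
    have "(Suc k * (2 * Suc k choose Suc k)) = 2 * (2 * k + 1) * (2 * k choose k)"
    proof -
      have "Suc k * (2 * Suc k choose Suc k) = Suc (2 * k + 1) * (2 * k + 1 choose k)"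
        using Suc_times_binomial[of k "2 * k + 1"] by simp
      also have "\<dots> = 2 * (Suc k * (Suc (2 * k) choose Suc k))"
        using binomial_symmetric[of k "2 * k + 1"] by simp
      also have "Suc k * (Suc (2 * k) choose Suc k) = Suc (2 * k) * (2 * k choose k)"
        by (rule Suc_times_binomial)
      finally show ?thesis by simp
    qed
    then show ?thesis by (metis (mono_tags) of_nat_mult of_nat_add of_nat_numeral of_nat_1)
  qed
  let ?m = "int n"
  have b1: "(?m + 1) * int ((2 * Suc n) choose Suc n) = 2 * (2 * ?m + 1) * int ((2 * n) choose n)"
    using b[of n] by (simp add: algebra_simps)
  have b2: "(?m + 2) * int ((2 * Suc (Suc n)) choose Suc (Suc n))
      = 2 * (2 * ?m + 3) * int ((2 * Suc n) choose Suc n)"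
    using b[of "Suc n"] by (simp add: algebra_simps)
  have w: "(?m + 2) ^ 2 * W (Suc (Suc n)) =
     - (9 * (?m + 2) * (?m + 1) + 3) * W (Suc n) - 27 * (?m + 1) ^ 2 * W n"
    using W_rec[of n] by (simp add: add.commute)
  have "(?m + 2) ^ 3 * v (Suc (Suc n)) =
     - 2 * (2 * ?m + 3) * (9 * (?m + 2) * (?m + 1) + 3) * v (Suc n)
     - 108 * (2 * ?m + 3) * (2 * ?m + 1) * (?m + 1) * v n"
    using b1 b2 w unfolding v_def by algebra
  then show ?thesis by (simp add: add.commute)
qed

text \<open>The recurrence \<open>V_rec\<close> as \<open>\<theta>^3 V = - 2 z (2\<theta> +
  1)(9\<theta>(\<theta> + 1) + 3) V - 108 z^2 (2\<theta> + 1)(2\<theta> + 3)(\<theta> + 1)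
  V\<close>, expanded.\<close>

lemma V_fps_ode:
  defines "V1 \<equiv> fps_XD V_fps"
  defines "V2 \<equiv> fps_XD V1"
  shows "fps_XD V2 = - fps_X * (36 * fps_XD V2 + 54 * V2 + 30 * V1 + 6 * V_fps)
      - 108 * fps_X ^ 2 * (4 * fps_XD V2 + 12 * V2 + 11 * V1 + 3 * V_fps)"
proof (rule fps_ext)
  fix n
  \<comment> \<open>The recurrence starts at index 2; coefficient 1 is checked from these two
    values.\<close>
  have W1: "W (Suc 0) = - 3" "W 0 = 1" by (simp_all add: W_def)
  show "fps_XD V2 $ n = (- fps_X * (36 * fps_XD V2 + 54 * V2 + 30 * V1 + 6 * V_fps)
      - 108 * fps_X ^ 2 * (4 * fps_XD V2 + 12 * V2 + 11 * V1 + 3 * V_fps)) $ n"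
  proof (cases n)
    case 0
    then show ?thesis by (simp add: V1_def V2_def power2_eq_square mult.assoc numeral_fps_const)
  next
    case n: (Suc m)
    show ?thesis
    proof (cases m)
      case 0
      then show ?thesis using n
        by (simp add: V1_def V2_def V_fps_def power2_eq_square mult.assoc numeral_fps_const W1)
    next
      case (Suc k)
      then show ?thesis using n V_rec[of k]
        by (simp add: V1_def V2_def V_fps_def power2_eq_square mult.assoc numeral_fps_const
              del: binomial_Suc_Suc mult_Suc_right)
           (simp add: algebra_simps power3_eq_cube del: binomial_Suc_Suc mult_Suc_right)
    qed
  qed
qed

section \<open>The symmetric square of the equation for \<open>W_fps\<close>\<close>

definition dA :: "int fps \<Rightarrow> int fps" where "dA f = AX * fps_XD f"

lemma dA_diff: "dA (f - g) = dA f - dA g"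
  by (simp add: dA_def fps_XD_diff algebra_simps)

text \<open>The derivation \<open>dA\<close> removes the first-order term: with primes for
  \<open>dA\<close> and \<open>q = AX CX\<close>, the equation reads \<open>U'' = q U\<close>. Then
  \<open>(U^2)''' = 4 q (U^2)' + 2 q' U^2\<close>.\<close>

lemma W_fps_square_ode:
  "dA (dA (dA (W_fps ^ 2))) = 4 * (AX * CX) * dA (W_fps ^ 2) + 2 * dA (AX * CX) * W_fps ^ 2"
proof -
  have d2: "dA (dA W_fps) = AX * CX * W_fps"
    by (simp add: dA_def W_fps_ode)
  have dm: "dA (f * g) = dA f * g + f * dA g" for f g
    by (simp add: dA_def fps_XD_mult algebra_simps)
  have da: "dA (f + g) = dA f + dA g" for f g
    by (simp add: dA_def algebra_simps)
  show ?thesis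
    unfolding power2_eq_square dm da d2 by algebra
qed

section \<open>Pullback of the equation for \<open>V_fps\<close> along \<open>zX\<close>\<close>

definition DX :: "int fps" where "DX = 1 - 27 * fps_X ^ 2"
text \<open>The geometric series for \<open>1 / DX\<close>, given by its coefficients so that
  everything stays over the integers; thus \<open>zX = X AX / DX^2\<close>.\<close>

definition IX :: "int fps" where "IX = Abs_fps (\<lambda>n. if even n then 27 ^ (n div 2) else 0)"
definition zX :: "int fps" where "zX = fps_X * AX * IX ^ 2"

lemma DX_IX: "DX * IX = 1"
proof (rule fps_ext)
  fix n
  show "(DX * IX) $ n = (1 :: int fps) $ n"
  proof (cases n)
    case n: (Suc m)
    show ?thesis
      by (cases m) (use n in \<open>auto simp: DX_def IX_def left_diff_distrib power2_eq_square mult.assoc numeral_fps_const\<close>)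
  qed (simp add: DX_def IX_def left_diff_distrib power2_eq_square mult.assoc numeral_fps_const)
qed

lemma zX_0 [simp]: "zX $ 0 = 0"
  by (simp add: zX_def mult.assoc)

text \<open>Express everything through the derivatives \<open>G0\<close>, ..., \<open>G3\<close> of
  \<open>V\<close> taken at \<open>zX\<close>, eliminate \<open>G3\<close> by the equation for
  \<open>V\<close>, and compare the cofactors of \<open>G0\<close>, \<open>G1\<close>,
  \<open>G2\<close>, which are polynomials in \<open>X\<close> up to a power of
  \<open>I\<close>.\<close>

lemma V_compose_ode:
  defines "R \<equiv> IX * (V_fps oo zX)"
  shows "dA (dA (dA R)) = 4 * (AX * CX) * dA R + 2 * dA (AX * CX) * R"
proof -
  let ?X = "fps_X :: int fps"
  \<comment> \<open>\<open>N = DX (AX + \<theta>AX) + 108 X^2 AX\<close> is the numerator of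
    \<open>AX\<close> times the logarithmic derivative of \<open>zX\<close>, whose denominator is
    \<open>DX\<close>.\<close>
  define N where "N = 1 + 18 * ?X + 162 * ?X ^ 2 + 486 * ?X ^ 3 + 729 * ?X ^ 4"
  define I where "I = IX"
  define G0 where "G0 = V_fps oo zX"
  define G1 where "G1 = fps_XD V_fps oo zX"
  define G2 where "G2 = fps_XD (fps_XD V_fps) oo zX"
  define G3 where "G3 = fps_XD (fps_XD (fps_XD V_fps)) oo zX"
  have DI: "(1 - 27 * ?X ^ 2) * I = 1" using DX_IX by (simp add: DX_def I_def)
  have "fps_XD ((1 - 27 * ?X ^ 2) * I) = 0" unfolding DI by simp
  then have "(1 - 27 * ?X ^ 2) * fps_XD I = 54 * ?X ^ 2 * I"
    by (simp add: fps_XD_mult fps_XD_diff fps_XD_power2 power2_eq_square algebra_simps)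
  then have XI: "fps_XD I = 54 * ?X ^ 2 * I ^ 2" using DI by algebra
  have XN: "fps_XD N = 18 * ?X + 324 * ?X ^ 2 + 1458 * ?X ^ 3 + 2916 * ?X ^ 4"
  proof -
    have N: "N = 1 + 18 * ?X + 162 * ?X ^ 2 + 486 * ?X ^ 3 + 729 * (?X ^ 2) ^ 2"
      unfolding N_def by algebra
    show ?thesis unfolding N fps_XD_add fps_XD_mult fps_XD_power2 fps_XD_power3 fps_XD_fps_X
        fps_XD_numeral fps_XD_1 by algebra
  qed
  have Xz: "AX * fps_XD zX = zX * (N * I)"
    unfolding zX_def I_def[symmetric] fps_XD_mult fps_XD_power2 XI XD_AX fps_XD_fps_X
    using DI unfolding AX_def N_def by algebra
  have XG0: "AX * fps_XD G0 = G1 * (N * I)" and XG1: "AX * fps_XD G1 = G2 * (N * I)"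
    and XG2: "AX * fps_XD G2 = G3 * (N * I)"
    unfolding G0_def G1_def G2_def G3_def by (rule fps_XD_compose[OF zX_0 Xz])+
  have G3: "G3 = - zX * (36 * G3 + 54 * G2 + 30 * G1 + 6 * G0)
      - 108 * zX ^ 2 * (4 * G3 + 12 * G2 + 11 * G1 + 3 * G0)"
    unfolding G0_def G1_def G2_def G3_def
    by (subst V_fps_ode)
       (simp add: fps_compose_mult_distrib fps_compose_add_distrib fps_compose_sub_distrib
          fps_compose_uminus fps_compose_power[symmetric])
  \<comment> \<open>The leading coefficient of the equation for \<open>V\<close> becomes the perfect
    square \<open>(N / DX^2)^2\<close>.\<close>
  have NS: "N ^ 2 * I ^ 4 = 1 + 36 * zX + 432 * zX ^ 2"
    unfolding zX_def I_def[symmetric] using DI unfolding N_def AX_def by algebra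
  define D where "D = 1 - 27 * ?X ^ 2"
  have DI': "D * I = 1" using DI by (simp add: D_def)
  have XD: "fps_XD D = - 54 * ?X ^ 2"
    by (simp add: D_def fps_XD_mult fps_XD_diff fps_XD_power2 power2_eq_square)
  have DG0: "D * dA G0 = N * G1" and DG1: "D * dA G1 = N * G2" and DG2: "D * dA G2 = N * G3"
    unfolding dA_def XG0 XG1 XG2 using DI' by (simp_all add: algebra_simps)
  have dA_mult: "dA (f * g) = dA f * g + f * dA g" for f g
    by (simp add: dA_def fps_XD_mult algebra_simps)
  have dA_add: "dA (f + g) = dA f + dA g" for f g
    by (simp add: dA_def algebra_simps)
  have dI: "dA I = 54 * ?X ^ 2 * AX * I ^ 2" by (simp add: dA_def XI)
  \<comment> \<open>\<open>D * dA\<close> is a derivation sending \<open>G\<^sub>i\<close> to \<open>N * G\<^sub>i\<^sub>+\<^sub>1\<close>, so each \<open>dA\<close> costs one factor \<open>I\<close>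
    and the cofactors remain polynomial.\<close>
  have dI1: "dA (I * f) = I ^ 2 * (54 * ?X ^ 2 * AX * f + D * dA f)" for f
    unfolding dA_mult dI using DI' by algebra
  have dI2: "dA (I ^ 2 * f) = I ^ 3 * (108 * ?X ^ 2 * AX * f + D * dA f)" for f
    unfolding dA_mult power2_eq_square[of I] dI using DI' by algebra
  have dI3: "dA (I ^ 3 * f) = I ^ 4 * (162 * ?X ^ 2 * AX * f + D * dA f)" for f
    unfolding dA_mult power3_eq_cube[of I] dI using DI' by algebra
  have R1: "dA R = I ^ 2 * (54 * AX * ?X ^ 2 * G0 + N * G1)"
    unfolding R_def I_def[symmetric] G0_def[symmetric] dI1 DG0 by algebra
  \<comment> \<open>The cofactors of \<open>G0\<close>, \<open>G1\<close>, \<open>G2\<close> in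
    \<open>dA (dA R)\<close> after \<open>I^3\<close> is taken out.\<close>
  define a0 where "a0 = 54 * AX * ?X ^ 2 * (108 * ?X ^ 2 * AX + D * (fps_XD AX + 2 * AX))"
  define a1 where "a1 = AX * (162 * ?X ^ 2 * N + D * fps_XD N)"
  define a2 where "a2 = N ^ 2"
  have R2: "dA (dA R) = I ^ 3 * (a0 * G0 + a1 * G1 + a2 * G2)"
  proof -
    have d0: "dA (54 * AX * ?X ^ 2) = 54 * AX * ?X ^ 2 * (fps_XD AX + 2 * AX)"
      unfolding dA_def fps_XD_mult fps_XD_power2 fps_XD_fps_X fps_XD_numeral by algebra
    have dN: "dA N = AX * fps_XD N" by (simp add: dA_def)
    have "dA (dA R) = I ^ 3 * (108 * ?X ^ 2 * AX * (54 * AX * ?X ^ 2 * G0 + N * G1)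
        + (D * dA (54 * AX * ?X ^ 2) * G0 + 54 * AX * ?X ^ 2 * (D * dA G0)
        + D * dA N * G1 + N * (D * dA G1)))"
      unfolding R1 dI2 dA_add dA_mult[of _ G0] dA_mult[of _ G1] by algebra
    also have "\<dots> = I ^ 3 * (a0 * G0 + a1 * G1 + a2 * G2)"
      unfolding DG0 DG1 d0 dN a0_def a1_def a2_def by algebra
    finally show ?thesis .
  qed
  have X2: "fps_XD (?X ^ 2) = 2 * ?X ^ 2"
    unfolding fps_XD_power2 fps_XD_fps_X by algebra
  have X3: "fps_XD (?X ^ 3) = 3 * ?X ^ 3"
    unfolding fps_XD_power3 fps_XD_fps_X by algebra
  have X4: "fps_XD (?X ^ 4) = 4 * ?X ^ 4"
    using fps_XD_mult[of "?X ^ 2" "?X ^ 2"] X2 by (simp flip: power_add)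
  have XXA: "fps_XD (fps_XD AX) = 9 * ?X + 108 * ?X ^ 2"
    unfolding XD_AX by (simp add: fps_XD_mult X2)
  have XXN: "fps_XD (fps_XD N) = 18 * ?X + 648 * ?X ^ 2 + 4374 * ?X ^ 3 + 11664 * ?X ^ 4"
    unfolding XN by (simp add: fps_XD_mult X2 X3 X4)
  have Xa0: "fps_XD a0 = 54 * (fps_XD AX * ?X ^ 2 + 2 * AX * ?X ^ 2)
        * (108 * ?X ^ 2 * AX + D * (fps_XD AX + 2 * AX))
      + 54 * AX * ?X ^ 2 * (216 * ?X ^ 2 * AX + 108 * ?X ^ 2 * fps_XD AX
        - 54 * ?X ^ 2 * (fps_XD AX + 2 * AX) + D * (fps_XD (fps_XD AX) + 2 * fps_XD AX))"
    unfolding a0_def fps_XD_mult fps_XD_add fps_XD_numeral X2 XD by algebra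
  have Xa1: "fps_XD a1 = fps_XD AX * (162 * ?X ^ 2 * N + D * fps_XD N)
      + AX * (324 * ?X ^ 2 * N + 108 * ?X ^ 2 * fps_XD N + D * fps_XD (fps_XD N))"
    unfolding a1_def fps_XD_mult fps_XD_add fps_XD_numeral X2 XD by algebra
  have Xa2: "fps_XD a2 = 2 * N * fps_XD N"
    unfolding a2_def by (rule fps_XD_power2)
  have R3: "dA (dA (dA R)) = I ^ 4 * (162 * ?X ^ 2 * AX * (a0 * G0 + a1 * G1 + a2 * G2)
      + D * AX * (fps_XD a0 * G0 + fps_XD a1 * G1 + fps_XD a2 * G2) + N * (a0 * G1 + a1 * G2 + a2 * G3))"
  proof -
    have "dA (dA (dA R)) = I ^ 4 * (162 * ?X ^ 2 * AX * (a0 * G0 + a1 * G1 + a2 * G2)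
        + (D * dA a0 * G0 + a0 * (D * dA G0) + D * dA a1 * G1 + a1 * (D * dA G1)
        + D * dA a2 * G2 + a2 * (D * dA G2)))"
      unfolding R2 dI3 dA_add dA_mult[of _ G0] dA_mult[of _ G1] dA_mult[of _ G2] by algebra
    also have "\<dots> = I ^ 4 * (162 * ?X ^ 2 * AX * (a0 * G0 + a1 * G1 + a2 * G2)
      + D * AX * (fps_XD a0 * G0 + fps_XD a1 * G1 + fps_XD a2 * G2) + N * (a0 * G1 + a1 * G2 + a2 * G3))"
      unfolding DG0 DG1 DG2 unfolding dA_def by algebra
    finally show ?thesis .
  qed
  \<comment> \<open>By \<open>NS\<close>, \<open>I^4 a2\<close> is exactly the leading coefficient
    of the equation for \<open>V\<close>, so \<open>G3\<close> is replaced by lower derivatives.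
    Each power of \<open>zX\<close> is written with the factor \<open>I^4\<close>.\<close>
  have G3': "I ^ 4 * a2 * G3 = - (I ^ 4) * (?X * AX * D ^ 2 * (54 * G2 + 30 * G1 + 6 * G0)
      + 108 * ?X ^ 2 * AX ^ 2 * (12 * G2 + 11 * G1 + 3 * G0))"
  proof -
    have I2: "I ^ 2 = I ^ 4 * D ^ 2" using DI' by algebra
    have "I ^ 4 * a2 * G3 = (1 + 36 * zX + 432 * zX ^ 2) * G3"
      unfolding a2_def NS[symmetric] by algebra
    also have "\<dots> = - zX * (54 * G2 + 30 * G1 + 6 * G0)
        - 108 * zX ^ 2 * (12 * G2 + 11 * G1 + 3 * G0)"
      using G3 by algebra
    also have "zX = ?X * AX * D ^ 2 * I ^ 4"
      unfolding zX_def I_def[symmetric] I2 by algebra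
    also have "(?X * AX * D ^ 2 * I ^ 4) ^ 2 = ?X ^ 2 * AX ^ 2 * I ^ 4"
      using DI' by algebra
    finally show ?thesis by algebra
  qed
  \<comment> \<open>In \<open>c2\<close>, \<open>c1\<close>, \<open>c0\<close> the parts with factor
    \<open>N\<close> and terms in \<open>X AX D^2\<close> and \<open>X^2 AX^2\<close> cancel against
    \<open>G3'\<close>. What is left is the right-hand side of the claim: nothing at
    \<open>G2\<close>, and the contributions of \<open>dA R\<close> and \<open>R\<close> at
    \<open>G1\<close> and \<open>G0\<close>.\<close>
  have c2: "162 * ?X ^ 2 * AX * a2 + D * AX * fps_XD a2 + N * a1
      = N * (54 * ?X * AX * D ^ 2 + 1296 * ?X ^ 2 * AX ^ 2)"
    unfolding Xa2 unfolding a1_def a2_def unfolding XN unfolding N_def AX_def D_def 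
    by (simp add: algebra_simps power2_eq_square power3_eq_cube power4_eq_xxxx)
  have c1: "162 * ?X ^ 2 * AX * a1 + D * AX * fps_XD a1 + N * a0
      = N * (30 * ?X * AX * D ^ 2 + 1188 * ?X ^ 2 * AX ^ 2) + 4 * AX * CX * N * D ^ 2"
    unfolding Xa1 unfolding a0_def a1_def unfolding XXN unfolding XN XD_AX unfolding N_def AX_def CX_def D_def 
    by (simp add: algebra_simps power2_eq_square power3_eq_cube power4_eq_xxxx)
  have c0: "162 * ?X ^ 2 * AX * a0 + D * AX * fps_XD a0
      = N * (6 * ?X * AX * D ^ 2 + 324 * ?X ^ 2 * AX ^ 2) + 216 * AX ^ 2 * CX * ?X ^ 2 * D ^ 2
        + 2 * AX * (fps_XD AX * CX + AX * fps_XD CX) * D ^ 3"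
    unfolding Xa0 unfolding a0_def unfolding XXA unfolding XD_AX XD_CX unfolding N_def AX_def CX_def D_def 
    by (simp add: algebra_simps power2_eq_square power3_eq_cube power4_eq_xxxx)
  have r0: "R = I ^ 4 * D ^ 3 * G0"
    unfolding R_def I_def[symmetric] G0_def[symmetric] using DI' by algebra
  have r1: "dA R = I ^ 4 * D ^ 2 * (54 * AX * ?X ^ 2 * G0 + N * G1)"
  proof -
    have "I ^ 2 = I ^ 4 * D ^ 2" using DI' by algebra
    then show ?thesis unfolding R1 by simp
  qed
  have rq: "dA (AX * CX) = AX * (fps_XD AX * CX + AX * fps_XD CX)"
    by (simp add: dA_def fps_XD_mult)
  have r3: "dA (dA (dA R)) = I ^ 4 *
      ((162 * ?X ^ 2 * AX * a0 + D * AX * fps_XD a0) * G0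
      + (162 * ?X ^ 2 * AX * a1 + D * AX * fps_XD a1 + N * a0) * G1
      + (162 * ?X ^ 2 * AX * a2 + D * AX * fps_XD a2 + N * a1) * G2) + N * (I ^ 4 * a2 * G3)"
    unfolding R3 by algebra
  show ?thesis
    unfolding r3 unfolding c0 c1 c2 G3' r1 rq unfolding r0
    by (simp add: algebra_simps power2_eq_square power3_eq_cube)
qed

text \<open>The lowest coefficient \<open>h\<^sub>n\<close> of a difference of solutions satisfies \<open>n\<^sup>3 h\<^sub>n = 0\<close>.\<close>

lemma ode_unique:
  assumes "dA (dA (dA f)) = 4 * (AX * CX) * dA f + 2 * dA (AX * CX) * f"
    and "dA (dA (dA g)) = 4 * (AX * CX) * dA g + 2 * dA (AX * CX) * g"
    and "f $ 0 = g $ 0"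
  shows "f = g"
proof (rule ccontr)
  define h where "h = f - g"
  assume "f \<noteq> g"
  then have "\<exists>n. h $ n \<noteq> 0" by (auto simp: h_def fps_eq_iff)
  then have n: "h $ (LEAST n. h $ n \<noteq> 0) \<noteq> 0" by (rule LeastI_ex)
  define n where "n = (LEAST n. h $ n \<noteq> 0)"
  have low: "h $ i = 0" if "i < n" for i
    using not_less_Least[of i "\<lambda>n. h $ n \<noteq> 0"] that unfolding n_def by blast
  have "n \<noteq> 0" using n assms(3) unfolding n_def[symmetric] by (intro notI) (simp add: h_def)
  have h: "dA (dA (dA h)) = 4 * (AX * CX) * dA h + 2 * dA (AX * CX) * h"
    unfolding h_def dA_diff using assms(1,2) by (simp add: algebra_simps)
  have mult: "(c * k) $ i = (if i < n then 0 else c $ 0 * k $ n)"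
    if "i \<le> n" and "\<And>j. j < n \<Longrightarrow> k $ j = 0" for i and c k :: "int fps"
  proof -
    have "(c * k) $ i = (\<Sum>j = 0..i. c $ j * k $ (i - j))" by (simp add: fps_mult_nth)
    also have "\<dots> = (\<Sum>j = 0..i. if j = 0 then c $ 0 * k $ i else 0)"
      using that by (intro sum.cong) auto
    also have "\<dots> = c $ 0 * k $ i" by simp
    finally show ?thesis using that by auto
  qed
  \<comment> \<open>Constant term 1 of \<open>AX\<close> makes \<open>dA\<close> multiply the lowest
    coefficient by \<open>n\<close>; the vanishing constant terms in \<open>C0\<close> kill the
    right-hand side at index \<open>n\<close>.\<close>
  have A0: "AX $ 0 = 1" and C0: "(AX * CX) $ 0 = 0" "dA (AX * CX) $ 0 = 0"
    by (simp_all add: AX_def CX_def dA_def)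
  have d: "dA k $ i = (if i < n then 0 else int n * k $ n)"
    if "i \<le> n" and "\<And>j. j < n \<Longrightarrow> k $ j = 0" for i k
    unfolding dA_def using that by (subst mult) (auto simp: A0)
  have d1: "dA h $ i = (if i < n then 0 else int n * h $ n)" if "i \<le> n" for i
    using d that low by blast
  have d2: "dA (dA h) $ i = (if i < n then 0 else int n * (int n * h $ n))" if "i \<le> n" for i
    using d[of i "dA h"] that d1 by simp
  have "dA (dA (dA h)) $ n = int n * (int n * (int n * h $ n))"
    using d[of n "dA (dA h)"] d2 by simp
  moreover have "(4 * (AX * CX) * dA h) $ n = 0" "(2 * dA (AX * CX) * h) $ n = 0"
    using mult[of n "dA h" "4 * (AX * CX)"] mult[of n h "2 * dA (AX * CX)"] d1 low C0
    by (simp_all)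
  ultimately show False using h n \<open>n \<noteq> 0\<close> unfolding n_def[symmetric] by simp
qed

text \<open>Both sides solve the same third-order equation and have constant term 1.\<close>

lemma W_fps_square: "W_fps ^ 2 = IX * (V_fps oo zX)"
  by (rule ode_unique[OF W_fps_square_ode V_compose_ode])
     (simp add: W_fps_def V_fps_def IX_def W_def power2_eq_square)

subsection \<open>Rationals integral at a prime\<close>

text \<open>Any denominator prime to \<open>p\<close> may be used, not just the one in lowest terms;
  closure under ring operations then becomes arithmetic of fractions.\<close>

lemma p_integral_iff:
  assumes "prime p"
  shows "x \<in> p_integral p \<longleftrightarrow> (\<exists>a b. \<not> int p dvd b \<and> x = of_int a / of_int b)"
proof
  assume "x \<in> p_integral p"
  then show "\<exists>a b. \<not> int p dvd b \<and> x = of_int a / of_int b"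
    unfolding p_integral_def by (metis (mono_tags, lifting) mem_Collect_eq prod.collapse quotient_of_div)
next
  assume "\<exists>a b. \<not> int p dvd b \<and> x = of_int a / of_int b"
  then obtain a b where ab: "\<not> int p dvd b" "x = of_int a / of_int b" by blast
  obtain c d where cd: "quotient_of x = (c, d)" by fastforce
  have "d > 0" "coprime c d" "x = of_int c / of_int d"
    using cd quotient_of_denom_pos quotient_of_coprime quotient_of_div by blast+
  moreover have "b \<noteq> 0" using ab by auto
  ultimately have "(of_int (a * d) :: rat) = of_int (c * b)"
    using ab(2) by (simp add: field_simps)
  then have e: "a * d = c * b" by (simp only: of_int_eq_iff)
  have "\<not> int p dvd d"
  proof
    assume d: "int p dvd d"
    then have "int p dvd c * b" using e by (metis dvd_mult)
    then have "int p dvd c" using ab(1) assms by (simp add: prime_dvd_mult_iff)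
    then have "int p dvd 1" using d \<open>coprime c d\<close> by (metis coprime_def)
    then show False using assms by simp
  qed
  then show "x \<in> p_integral p" by (simp add: p_integral_def cd)
qed

lemma p_integral_of_int: "prime p \<Longrightarrow> of_int a \<in> p_integral p"
  using not_prime_1 by (auto simp: p_integral_def)

lemma p_integral_mult:
  assumes "prime p" "x \<in> p_integral p" "y \<in> p_integral p"
  shows "x * y \<in> p_integral p"
proof -
  obtain a b c d where "\<not> int p dvd b" "x = of_int a / of_int b" "\<not> int p dvd d" "y = of_int c / of_int d"
    using assms by (auto simp: p_integral_iff)
  then have "\<not> int p dvd b * d" "x * y = of_int (a * c) / of_int (b * d)"
    using assms(1) by (auto simp: prime_dvd_mult_iff)
  then show ?thesis using assms(1) p_integral_iff by blast
qed

lemma p_integral_add: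
  assumes "prime p" "x \<in> p_integral p" "y \<in> p_integral p"
  shows "x + y \<in> p_integral p"
proof -
  obtain a b c d where *: "\<not> int p dvd b" "x = of_int a / of_int b" "\<not> int p dvd d" "y = of_int c / of_int d"
    using assms by (auto simp: p_integral_iff)
  then have "b \<noteq> 0" "d \<noteq> 0" by auto
  with * have "\<not> int p dvd b * d" "x + y = of_int (a * d + c * b) / of_int (b * d)"
    using assms(1) by (auto simp: prime_dvd_mult_iff field_simps)
  then show ?thesis using assms(1) p_integral_iff by blast
qed

lemma p_integral_power:
  "prime p \<Longrightarrow> x \<in> p_integral p \<Longrightarrow> x ^ n \<in> p_integral p"
  by (induction n) (use p_integral_of_int[of p 1] in \<open>auto intro: p_integral_mult\<close>)

lemma p_integral_sum:
  assumes "prime p" "\<And>i. i \<in> S \<Longrightarrow> f i \<in> p_integral p"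
  shows "sum f S \<in> p_integral p"
  using assms(2) p_integral_of_int[OF assms(1), of 0]
  by (induction S rule: infinite_finite_induct) (auto intro: p_integral_add[OF assms(1)])

lemma p_cong_of_int:
  assumes "prime p" "[a = b] (mod int p)"
  shows "p_cong p (of_int a) (of_int b)"
proof -
  obtain c where "a - b = int p * c" using assms(2) by (metis cong_iff_dvd_diff dvdE)
  then have "(of_int a - of_int b :: rat) = of_nat p * of_int c"
    by (metis of_int_diff of_int_mult of_int_of_nat_eq)
  then show ?thesis using p_integral_of_int[OF assms(1)] by (auto simp: p_cong_def)
qed

lemma p_cong_refl: "prime p \<Longrightarrow> p_cong p x x"
  using p_integral_of_int[of p 0] by (auto simp: p_cong_def)

lemma p_cong_add:
  assumes "prime p" "p_cong p x x'" "p_cong p y y'"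
  shows "p_cong p (x + y) (x' + y')"
proof -
  obtain c d where cd: "c \<in> p_integral p" "d \<in> p_integral p" "x - x' = of_nat p * c" "y - y' = of_nat p * d"
    using assms(2,3) by (auto simp: p_cong_def)
  then have "x + y - (x' + y') = of_nat p * (c + d)" by (simp add: algebra_simps)
  then show ?thesis using p_integral_add[OF assms(1) cd(1,2)] by (auto simp: p_cong_def)
qed

text \<open>From \<open>x y - x' y' = x (y - y') + (x - x') y'\<close>, whence the integrality
  assumptions on \<open>x\<close> and \<open>y'\<close>.\<close>

lemma p_cong_mult:
  assumes "prime p" "p_cong p x x'" "p_cong p y y'" "x \<in> p_integral p" "y' \<in> p_integral p"
  shows "p_cong p (x * y) (x' * y')"
proof -
  obtain c d where cd: "c \<in> p_integral p" "d \<in> p_integral p" "x - x' = of_nat p * c" "y - y' = of_nat p * d"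
    using assms(2,3) by (auto simp: p_cong_def)
  have "x * y - x' * y' = x * (y - y') + (x - x') * y'" by (simp add: algebra_simps)
  also have "\<dots> = of_nat p * (x * d + c * y')" by (simp add: cd algebra_simps)
  finally have "x * y - x' * y' = of_nat p * (x * d + c * y')" .
  moreover have "x * d + c * y' \<in> p_integral p"
    using assms cd by (intro p_integral_add p_integral_mult)
  ultimately show ?thesis by (auto simp: p_cong_def)
qed

lemma p_cong_sym:
  assumes "prime p" "p_cong p x y"
  shows "p_cong p y x"
proof -
  obtain c where c: "c \<in> p_integral p" "x - y = of_nat p * c" using assms(2) by (auto simp: p_cong_def)
  then have "y - x = of_nat p * (of_int (- 1) * c)" by (simp add: algebra_simps)
  moreover have "of_int (- 1) * c \<in> p_integral p"
    by (rule p_integral_mult[OF assms(1) p_integral_of_int[OF assms(1)] c(1)])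
  ultimately show ?thesis unfolding p_cong_def by blast
qed

lemma p_cong_trans:
  assumes "prime p" "p_cong p x y" "p_cong p y z"
  shows "p_cong p x z"
proof -
  \<comment> \<open>Add the two congruences, then subtract \<open>y\<close> from both sides.\<close>
  have "p_cong p (x + y + of_int (- 1) * y) (y + z + of_int (- 1) * y)"
    by (rule p_cong_add[OF assms(1) p_cong_add[OF assms] p_cong_refl[OF assms(1)]])
  then show ?thesis by simp
qed

lemma p_cong_power:
  assumes "prime p" "p_cong p x (of_int a)" "x \<in> p_integral p"
  shows "p_cong p (x ^ n) (of_int a ^ n)"
proof (induction n)
  case (Suc n)
  have "(of_int a ^ n :: rat) \<in> p_integral p"
    using p_integral_of_int[OF assms(1), of "a ^ n"] by simp
  then show ?case using p_cong_mult[OF assms(1,2) Suc assms(3)] by simp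
qed (simp add: p_cong_refl[OF assms(1)])

lemma p_cong_int_mult:
  assumes "prime p" "p_cong p x (of_int a)" "p_cong p y (of_int b)" "x \<in> p_integral p"
  shows "p_cong p (x * y) (of_int (a * b))"
  using p_cong_mult[OF assms(1-4) p_integral_of_int[OF assms(1)]] by simp

lemma p_cong_sum:
  assumes "prime p" "\<And>i. i \<in> S \<Longrightarrow> p_cong p (f i) (g i)"
  shows "p_cong p (sum f S) (sum g S)"
  using assms(2)
  by (induction S rule: infinite_finite_induct)
     (auto intro: p_cong_add[OF assms(1)] p_cong_refl[OF assms(1)])

text \<open>For \<open>x = a / b\<close> take \<open>m = a b'\<close> with \<open>b b' = 1\<close>
  modulo \<open>p\<close>.\<close>

lemma p_cong_residue:
  assumes "prime p" "x \<in> p_integral p"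
  obtains m where "p_cong p x (of_int m)"
proof -
  obtain a b where ab: "\<not> int p dvd b" "x = of_int a / of_int b"
    using assms by (auto simp: p_integral_iff)
  have "coprime b (int p)"
    using ab(1) assms(1) prime_imp_coprime[of "int p" b] by (simp add: coprime_commute)
  then obtain b' where "[b * b' = 1] (mod int p)" using cong_solve_coprime_int by blast
  then obtain t where "1 - b * b' = int p * t" by (metis cong_iff_dvd_diff cong_sym dvdE)
  then have t: "1 - of_int b * of_int b' = (of_nat p * of_int t :: rat)"
    by (metis of_int_1 of_int_diff of_int_mult of_int_of_nat_eq)
  have "b \<noteq> 0" using ab by auto
  then have "x - of_int (a * b') = of_int a * (1 - of_int b * of_int b') / of_int b"
    by (simp add: ab(2) field_simps)
  also have "\<dots> = of_nat p * (of_int (a * t) / of_int b)" by (simp add: t)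
  finally have "x - of_int (a * b') = of_nat p * (of_int (a * t) / of_int b)" .
  moreover have "(of_int (a * t) / of_int b :: rat) \<in> p_integral p"
    using ab(1) p_integral_iff[OF assms(1)] by blast
  ultimately have "p_cong p x (of_int (a * b'))" unfolding p_cong_def by blast
  then show ?thesis by (rule that)
qed

lemma p_integral_inverse:
  assumes "prime p" "x \<in> p_integral p" "\<not> p_cong p x 0"
  shows "1 / x \<in> p_integral p"
proof -
  obtain a b where ab: "\<not> int p dvd b" "x = of_int a / of_int b"
    using assms by (auto simp: p_integral_iff)
  have "\<not> int p dvd a"
  proof
    assume "int p dvd a"
    then obtain c where "a = int p * c" by blast
    then have "x - 0 = of_nat p * (of_int c / of_int b)" by (simp add: ab(2))
    moreover have "(of_int c / of_int b :: rat) \<in> p_integral p"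
      using ab(1) p_integral_iff[OF assms(1)] by blast
    ultimately show False using assms(3) unfolding p_cong_def by blast
  qed
  moreover have "1 / x = of_int b / of_int a" by (simp add: ab(2))
  ultimately show ?thesis using p_integral_iff[OF assms(1)] by blast
qed

subsection \<open>Reduction modulo a prime\<close>

text \<open>Insert the Lucas factorizations of \<open>W_fps\<close> and \<open>V_fps\<close> into
  \<open>W_fps_square\<close> and cancel the Frobenius twist \<open>U^2\<close>.\<close>

lemma truncated_fps_cong:
  assumes "prime p"
  shows "fps_cong p (fps_cutoff p W_fps ^ 2) (DX ^ (p - 1) * (fps_cutoff p V_fps oo zX))"
proof -
  let ?X = "fps_X ^ p :: int fps"
  define F where "F = fps_cutoff p W_fps"
  define G where "G = fps_cutoff p V_fps"
  define U where "U = W_fps oo ?X"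
  have p: "p > 0" using assms by (simp add: prime_gt_0_nat)
  have X0: "?X $ 0 = 0" using p by simp
  have fA: "frob p AX" and fD: "frob p DX"
    unfolding AX_def DX_def
    by (intro frob_add frob_diff frob_mult frob_power frob_numeral frob_fps_X frob_1 assms)+
  have fz: "frob p zX"
    unfolding zX_def
    by (intro frob_mult frob_power frob_fps_X fA frob_inverse[OF assms fD DX_IX] assms)
  have DIp: "(DX oo ?X) * (IX oo ?X) = 1"
    using DX_IX X0 by (metis fps_compose_1 fps_compose_mult_distrib)
  have U2: "U ^ 2 = (IX oo ?X) * ((V_fps oo zX) oo ?X)"
    unfolding U_def fps_compose_power[OF X0] W_fps_square by (rule fps_compose_mult_distrib[OF X0])
  have WU: "fps_cong p W_fps (F * U)"
    using lucas_seq_fps_cong[OF lucas_W[OF assms] p] by (simp add: F_def U_def W_fps_def)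
  have "fps_cong p V_fps (G * (V_fps oo ?X))"
    using lucas_seq_fps_cong[OF lucas_V[OF assms] p] by (simp add: G_def V_fps_def)
  then have "fps_cong p (V_fps oo zX) (G * (V_fps oo ?X) oo zX)"
    by (intro fps_cong_compose fps_cong_refl)
  also have "G * (V_fps oo ?X) oo zX = (G oo zX) * (V_fps oo zX ^ p)"
    using X0 by (simp add: fps_compose_mult_distrib fps_compose_assoc[symmetric] fps_X_power_compose)
  \<comment> \<open>Replacing \<open>zX^p\<close> by \<open>zX(X^p)\<close> turns the second factor
    into the Frobenius twist of \<open>V_fps oo zX\<close>.\<close>
  also have "fps_cong p ((G oo zX) * (V_fps oo zX ^ p)) ((G oo zX) * (V_fps oo (zX oo ?X)))"
    using fz unfolding frob_def by (intro fps_cong_mult fps_cong_compose fps_cong_refl)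
  also have "V_fps oo (zX oo ?X) = V_fps oo zX oo ?X"
    by (rule fps_compose_assoc[OF X0 zX_0])
  finally have VG: "fps_cong p (V_fps oo zX) ((G oo zX) * (V_fps oo zX oo ?X))" .

  have "fps_cong p (F ^ 2 * U ^ 2) (W_fps ^ 2)"
    unfolding power_mult_distrib[symmetric] by (rule fps_cong_power[OF fps_cong_sym[OF WU]])
  also have "W_fps ^ 2 = IX * (V_fps oo zX)" by (rule W_fps_square)
  also have "fps_cong p (IX * (V_fps oo zX)) (IX * ((G oo zX) * (V_fps oo zX oo ?X)))"
    by (intro fps_cong_mult fps_cong_refl VG)
  \<comment> \<open>\<open>W_fps_square\<close> at \<open>X^p\<close>, solved for its
    \<open>V\<close> factor.\<close>
  also have "V_fps oo zX oo ?X = (DX oo ?X) * U ^ 2"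
    unfolding U2 mult.assoc[symmetric] DIp by simp
  also have "IX * ((G oo zX) * ((DX oo ?X) * U ^ 2)) = (IX * (G oo zX) * U ^ 2) * (DX oo ?X)"
    by (simp only: mult_ac)
  also have "fps_cong p ((IX * (G oo zX) * U ^ 2) * (DX oo ?X)) ((IX * (G oo zX) * U ^ 2) * DX ^ p)"
    using fD unfolding frob_def by (intro fps_cong_mult[OF fps_cong_refl] fps_cong_sym[of p "DX ^ p"])
  \<comment> \<open>One factor \<open>DX\<close> is used up against \<open>IX\<close>, which leaves
    the exponent \<open>p - 1\<close>.\<close>
  also have "DX ^ p = DX * DX ^ (p - 1)"
    using p by (simp flip: power_Suc)
  also have "(IX * (G oo zX) * U ^ 2) * (DX * DX ^ (p - 1)) = (DX * IX) * (DX ^ (p - 1) * (G oo zX) * U ^ 2)"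
    by (simp only: mult_ac)
  also have "\<dots> = DX ^ (p - 1) * (G oo zX) * U ^ 2"
    unfolding DX_IX by simp
  finally show ?thesis
    unfolding F_def G_def
    by (rule fps_cong_cancel) (simp add: U_def W_fps_def W_def power2_eq_square)
qed

lemma fps_cutoff_eq_sum:
  fixes f :: "'a :: comm_ring_1 fps"
  shows "fps_cutoff n f = (\<Sum>k<n. fps_const (f $ k) * fps_X ^ k)"
  by (simp add: fps_eq_iff fps_sum_nth if_distrib cong: if_cong)

text \<open>Congruent polynomials can be evaluated at an integer; this is the passage from formal
  series to values.\<close>

lemma poly_cong:
  fixes P Q :: "int poly"
  assumes "fps_cong p (fps_of_poly P) (fps_of_poly Q)"
  shows "[poly P m = poly Q m] (mod int p)"
proof -
  have "int p dvd coeff (P - Q) i" for i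
    using assms by (simp add: fps_cong_def cong_iff_dvd_diff)
  then have "int p dvd poly (P - Q) m"
    unfolding poly_altdef by (intro dvd_sum) auto
  then show ?thesis by (simp add: cong_iff_dvd_diff)
qed

lemma central_binomial_cong_0:
  assumes "prime p" "k < p" "(p - 1) div 2 < k"
  shows "[int ((2 * k) choose k) = 0] (mod int p)"
  by (rule lucas_central(2)) (use assms in auto)

text \<open>Terms with \<open>k > (p - 1) div 2\<close> vanish modulo \<open>p\<close> through the
  central binomial coefficient. For the others \<open>2 k \<le> p - 1\<close>, so
  \<open>DX^(p-1)\<close> absorbs the denominator \<open>DX^(2k)\<close> of \<open>zX^k\<close>, and
  both sides are polynomials to be evaluated at \<open>m\<close>.\<close>

lemma W_square_poly_cong:
  assumes "prime p"
  shows "[(\<Sum>k<p. W k * m ^ k) ^ 2 = (\<Sum>k\<le>(p - 1) div 2. int ((2 * k) choose k) * W k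
      * (m * (1 + 9 * m + 27 * m ^ 2)) ^ k * (1 - 27 * m ^ 2) ^ (p - 1 - 2 * k))] (mod int p)"
proof -
  let ?h = "(p - 1) div 2"
  define v where "v = (\<lambda>k. int ((2 * k) choose k) * W k)"
  define P where "P = (\<Sum>k<p. monom (W k) k)"
  define Q where "Q = (\<Sum>k\<le>?h. smult (v k) ([:0, 1, 9, 27:] ^ k * [:1, 0, -27:] ^ (p - 1 - 2 * k)))"
  have p: "p > 0" using assms by (simp add: prime_gt_0_nat)
  have P: "fps_of_poly P = fps_cutoff p W_fps"
    by (simp add: P_def fps_cutoff_eq_sum fps_of_poly_sum fps_of_poly_monom W_fps_def)
  have A: "fps_of_poly [:0, 1, 9, 27:] = fps_X * AX"
    by (simp add: fps_of_poly_pCons AX_def numeral_fps_const algebra_simps power2_eq_square)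
  have D: "fps_of_poly [:1, 0, -27:] = DX"
    by (simp add: fps_of_poly_pCons DX_def numeral_fps_const algebra_simps power2_eq_square)
  have Q: "fps_of_poly Q = (\<Sum>k\<le>?h. fps_const (v k) * (fps_X * AX) ^ k * DX ^ (p - 1 - 2 * k))"
    by (simp only: Q_def fps_of_poly_sum fps_of_poly_smult fps_of_poly_mult fps_of_poly_power A D mult.assoc)
  have "DX ^ (p - 1) * (fps_cutoff p V_fps oo zX) = (\<Sum>k<p. fps_const (v k) * (DX ^ (p - 1) * zX ^ k))"
    by (simp add: fps_cutoff_eq_sum fps_compose_sum_distrib fps_compose_mult_distrib fps_X_power_compose
          sum_distrib_left V_fps_def v_def mult_ac)
  also have "fps_cong p \<dots> (\<Sum>k<p. if k \<le> ?h then fps_const (v k) * (DX ^ (p - 1) * zX ^ k) else 0)"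
  proof (rule fps_cong_sum)
    fix k assume k: "k \<in> {..<p}"
    show "fps_cong p (fps_const (v k) * (DX ^ (p - 1) * zX ^ k))
        (if k \<le> ?h then fps_const (v k) * (DX ^ (p - 1) * zX ^ k) else 0)"
    proof (cases "k \<le> ?h")
      case False
      then have "int p dvd v k"
        using central_binomial_cong_0[OF assms, of k] k by (simp add: v_def cong_0_iff)
      then show ?thesis using False by (simp add: fps_cong_def cong_0_iff)
    qed simp
  qed
  also have "(\<Sum>k<p. if k \<le> ?h then fps_const (v k) * (DX ^ (p - 1) * zX ^ k) else 0)
      = (\<Sum>k\<le>?h. fps_const (v k) * (DX ^ (p - 1) * zX ^ k))"
    using p by (intro sum.mono_neutral_cong_right) auto
  also have "\<dots> = fps_of_poly Q"
    unfolding Q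
  proof (rule sum.cong[OF refl])
    fix k assume "k \<in> {..?h}"
    then have "p - 1 - 2 * k + 2 * k = p - 1" by auto
    then have D: "DX ^ (p - 1) = DX ^ (p - 1 - 2 * k) * DX ^ (2 * k)"
      by (metis power_add)
    have DI: "DX ^ (2 * k) * IX ^ (2 * k) = 1"
      by (simp add: DX_IX flip: power_mult_distrib)
    have z: "zX ^ k = (fps_X * AX) ^ k * IX ^ (2 * k)"
      by (simp add: zX_def power_mult_distrib power_mult)
    have "fps_const (v k) * (DX ^ (p - 1) * zX ^ k)
        = fps_const (v k) * (fps_X * AX) ^ k * DX ^ (p - 1 - 2 * k) * (DX ^ (2 * k) * IX ^ (2 * k))"
      unfolding D z by (simp only: mult_ac)
    then show "fps_const (v k) * (DX ^ (p - 1) * zX ^ k)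
        = fps_const (v k) * (fps_X * AX) ^ k * DX ^ (p - 1 - 2 * k)"
      unfolding DI by simp
  qed
  finally have "fps_cong p (fps_of_poly (P ^ 2)) (fps_of_poly Q)"
    using truncated_fps_cong[OF assms] fps_cong_trans unfolding fps_of_poly_power P by blast
  then have "[poly (P ^ 2) m = poly Q m] (mod int p)" by (rule poly_cong)
  moreover have "poly [:0, 1, 9, 27:] m = m * (1 + 9 * m + 27 * m ^ 2)"
    by (simp add: algebra_simps power2_eq_square)
  moreover have "poly [:1, 0, -27:] m = 1 - 27 * m ^ 2"
    by (simp add: power2_eq_square)
  ultimately show ?thesis
    by (simp only: P_def Q_def v_def poly_sum poly_monom poly_smult poly_mult poly_power mult.assoc)
qed

text \<open>For \<open>d = 1 - 27 m^2\<close> with inverse \<open>e\<close>, Fermat gives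
  \<open>d^(p-1) = 1\<close>, hence \<open>d^(p-1-2k) = e^(2k)\<close> modulo \<open>p\<close>. The
  terms with larger \<open>k\<close> are restored at the end because they vanish.\<close>

lemma W_square_cong:
  assumes "prime p" and e: "[(1 - 27 * m ^ 2) * e = 1] (mod int p)"
  shows "[(\<Sum>k<p. W k * m ^ k) ^ 2 =
      (\<Sum>k<p. int ((2 * k) choose k) * (m * (1 + 9 * m + 27 * m ^ 2) * e ^ 2) ^ k * W k)] (mod int p)"
proof -
  let ?h = "(p - 1) div 2"
  define d where "d = 1 - 27 * m ^ 2"
  define a where "a = m * (1 + 9 * m + 27 * m ^ 2)"
  define v where "v = (\<lambda>k. int ((2 * k) choose k))"
  have p: "p > 0" using assms by (simp add: prime_gt_0_nat)
  have de: "[d * e = 1] (mod int p)" using e by (simp add: d_def)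
  have "[d ^ (p - 1) * (d * e) = d ^ (p - 1) * 1] (mod int p)"
    by (intro cong_mult de cong_refl)
  moreover have "d ^ (p - 1) * (d * e) = d ^ p * e"
    using p by (metis Suc_diff_1 mult.assoc power_Suc2)
  moreover have "[d ^ p * e = d * e] (mod int p)"
    by (intro cong_mult int_power_prime_cong assms cong_refl)
  ultimately have d1: "[d ^ (p - 1) = 1] (mod int p)"
    using de by (metis cong_sym cong_trans mult_1_right)
  have dk: "[d ^ (p - 1 - 2 * k) = e ^ (2 * k)] (mod int p)" if "k \<le> ?h" for k
  proof -
    have r: "p - 1 - 2 * k + 2 * k = p - 1" using that by auto
    have "[d ^ (p - 1 - 2 * k) * 1 ^ (2 * k) = d ^ (p - 1 - 2 * k) * (d * e) ^ (2 * k)] (mod int p)"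
      by (rule cong_mult[OF cong_refl cong_pow[OF cong_sym[OF de]]])
    also have "d ^ (p - 1 - 2 * k) * (d * e) ^ (2 * k) = d ^ (p - 1) * e ^ (2 * k)"
      unfolding power_mult_distrib mult.assoc[symmetric] power_add[symmetric] r ..
    also have "[d ^ (p - 1) * e ^ (2 * k) = 1 * e ^ (2 * k)] (mod int p)"
      by (rule cong_mult[OF d1 cong_refl])
    finally show ?thesis by simp
  qed
  have "[(\<Sum>k<p. W k * m ^ k) ^ 2 = (\<Sum>k\<le>?h. v k * W k * a ^ k * d ^ (p - 1 - 2 * k))] (mod int p)"
    using W_square_poly_cong[OF assms(1), of m] by (simp only: a_def d_def v_def)
  also have "[(\<Sum>k\<le>?h. v k * W k * a ^ k * d ^ (p - 1 - 2 * k))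
      = (\<Sum>k\<le>?h. v k * W k * a ^ k * e ^ (2 * k))] (mod int p)"
    by (intro cong_sum cong_mult cong_refl dk) auto
  also have "(\<Sum>k\<le>?h. v k * W k * a ^ k * e ^ (2 * k))
      = (\<Sum>k<p. if k \<le> ?h then v k * (a * e ^ 2) ^ k * W k else 0)"
    using p by (intro sum.mono_neutral_cong_left) (auto simp: power_mult_distrib power_mult)
  also have "[\<dots> = (\<Sum>k<p. v k * (a * e ^ 2) ^ k * W k)] (mod int p)"
  proof (rule cong_sum)
    fix k assume k: "k \<in> {..<p}"
    show "[(if k \<le> ?h then v k * (a * e ^ 2) ^ k * W k else 0) = v k * (a * e ^ 2) ^ k * W k] (mod int p)"
    proof (cases "k \<le> ?h")
      case False
      then have "int p dvd v k"
        using central_binomial_cong_0[OF assms(1), of k] k by (simp add: v_def cong_0_iff)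
      then show ?thesis using False by (simp add: cong_sym_eq[of 0] cong_0_iff)
    qed simp
  qed
  finally show ?thesis by (simp only: a_def v_def)
qed

section \<open>Transfer from integer residues to rationals integral at \<open>p\<close>\<close>

theorem corollary2p1:
  fixes p :: nat and x :: rat
  assumes "prime p" and "p > 3"
    and "x \<in> p_integral p"
    and "\<not> p_cong p ((x + 3) * (1 + 9 * x + 27 * x^2) * (1 + 9 * x)
            * (1 + 27 * x^2) * (1 - 27 * x^2)) 0"
  shows "p_cong p
    ((\<Sum>k = 0..p - 1. of_int (W k) * x ^ k)^2)
    (\<Sum>k = 0..p - 1. of_nat ((2 * k) choose k)
        * (x * (1 + 9 * x + 27 * x^2) / (1 - 27 * x^2)^2) ^ k * of_int (W k))"
proof -
  note p = assms(1)
  note [intro] = p_integral_of_int[OF p] p_integral_mult[OF p] p_integral_add[OF p]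
    p_integral_power[OF p] assms(3)
  have num [intro]: "numeral k \<in> p_integral p" for k
    using p_integral_of_int[OF p, of "numeral k"] by simp
  have nat [intro]: "of_nat j \<in> p_integral p" for j
    using p_integral_of_int[OF p, of "int j"] by simp
  have one [intro]: "1 \<in> p_integral p"
    using p_integral_of_int[OF p, of 1] by simp
  define D where "D = 1 - 27 * x ^ 2"
  define A where "A = 1 + 9 * x + 27 * x ^ 2"
  \<comment> \<open>Written as a sum, so that the closure rules for sums and products apply.\<close>
  have D_eq: "D = 1 + of_int (- 27) * x ^ 2" by (simp add: D_def)
  have D_int: "D \<in> p_integral p" unfolding D_eq by blast
  have A_int: "A \<in> p_integral p" unfolding A_def by blast
  \<comment> \<open>If \<open>D\<close> vanished modulo \<open>p\<close>, so would its product with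
    the integral cofactor \<open>B\<close>, against the hypothesis.\<close>
  have D_unit: "\<not> p_cong p D 0"
  proof
    assume "p_cong p D 0"
    moreover define B where "B = (x + 3) * A * (1 + 9 * x) * (1 + 27 * x ^ 2)"
    moreover have "B \<in> p_integral p" unfolding B_def using A_int by blast
    ultimately have "p_cong p (B * D) (B * 0)"
      using p_integral_of_int[OF p, of 0] by (intro p_cong_mult[OF p] p_cong_refl[OF p]) auto
    then show False using assms(4) by (simp add: B_def A_def D_def)
  qed
  obtain m where m: "p_cong p x (of_int m)"
    using p_cong_residue[OF p assms(3)] .
  have x2: "p_cong p (x ^ 2) (of_int (m ^ 2))"
    using p_cong_power[OF p m assms(3), of 2] by simp
  have self: "p_cong p (of_int a) (of_int a)" for a by (rule p_cong_refl[OF p])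
  have Dm: "p_cong p D (of_int (1 - 27 * m ^ 2))"
    using p_cong_add[OF p self[of 1] p_cong_int_mult[OF p self[of "- 27"] x2
          p_integral_of_int[OF p]]]
    unfolding D_eq by simp
  have Am: "p_cong p A (of_int (1 + 9 * m + 27 * m ^ 2))"
    using p_cong_add[OF p p_cong_add[OF p self[of 1] p_cong_int_mult[OF p self[of 9] m]]
        p_cong_int_mult[OF p self[of 27] x2]]
    unfolding A_def by auto
  have "\<not> int p dvd 1 - 27 * m ^ 2"
  proof
    assume "int p dvd 1 - 27 * m ^ 2"
    then have "p_cong p (of_int (1 - 27 * m ^ 2)) (of_int 0)"
      by (intro p_cong_of_int[OF p]) (simp add: cong_0_iff)
    then show False using D_unit p_cong_trans[OF p Dm] by simp
  qed
  then have "coprime (1 - 27 * m ^ 2) (int p)"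
    using p prime_imp_coprime[of "int p" "1 - 27 * m ^ 2"] by (simp add: coprime_commute)
  then obtain e where e: "[(1 - 27 * m ^ 2) * e = 1] (mod int p)"
    using cong_solve_coprime_int by blast
  have D_nz: "D \<noteq> 0" using D_unit p_cong_refl[OF p] by metis
  have inv_int: "1 / D \<in> p_integral p" by (rule p_integral_inverse[OF p D_int D_unit])
  \<comment> \<open>Multiply \<open>D e = 1\<close> modulo \<open>p\<close> by the integral number
    \<open>1 / D\<close>.\<close>
  have inv_e: "p_cong p (1 / D) (of_int e)"
  proof -
    have "p_cong p (D * of_int e) (of_int ((1 - 27 * m ^ 2) * e))"
      by (rule p_cong_int_mult[OF p Dm self D_int])
    then have "p_cong p (D * of_int e) (of_int 1)"
      using p_cong_trans[OF p] p_cong_of_int[OF p e] by blast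
    then have "p_cong p (1 / D * (D * of_int e)) (1 / D * of_int 1)"
      by (intro p_cong_mult[OF p] p_cong_refl[OF p] inv_int) auto
    then show ?thesis using D_nz p_cong_sym[OF p] by simp
  qed
  \<comment> \<open>\<open>y\<close> is the rational argument on the right-hand side and
    \<open>n\<close> its integer residue; the integer congruence is applied to \<open>m\<close> and
    \<open>n\<close> and carried back to \<open>x\<close> and \<open>y\<close>.\<close>
  define y where "y = x * A * (1 / D) ^ 2"
  define n where "n = m * (1 + 9 * m + 27 * m ^ 2) * e ^ 2"
  have y_int: "y \<in> p_integral p" unfolding y_def using A_int inv_int by blast
  have yn: "p_cong p y (of_int n)"
    unfolding y_def n_def
    using p_cong_power[OF p inv_e inv_int, of 2] A_int
    by (intro p_cong_int_mult[OF p] m Am) auto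
  have ivl: "{0..p - 1} = {..<p}" using prime_gt_0_nat[OF p] by auto
  define S where "S = (\<Sum>k<p. of_int (W k) * x ^ k)"
  have S_int: "S \<in> p_integral p"
    unfolding S_def by (intro p_integral_sum[OF p]) auto
  have S: "p_cong p S (of_int (\<Sum>k<p. W k * m ^ k))"
    unfolding S_def of_int_sum
    using p_cong_power[OF p m assms(3)]
    by (intro p_cong_sum[OF p] p_cong_int_mult[OF p] self) auto
  have T: "p_cong p (\<Sum>k<p. of_nat ((2 * k) choose k) * y ^ k * of_int (W k))
      (of_int (\<Sum>k<p. int ((2 * k) choose k) * n ^ k * W k))"
    unfolding of_int_sum
  proof (rule p_cong_sum[OF p])
    fix k
    have "p_cong p (of_int (int ((2 * k) choose k)) * y ^ k * of_int (W k))
        (of_int (int ((2 * k) choose k) * n ^ k * W k))"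
      using p_cong_power[OF p yn y_int, of k] y_int
      by (intro p_cong_int_mult[OF p] self) auto
    then show "p_cong p (of_nat ((2 * k) choose k) * y ^ k * of_int (W k))
        (of_int (int ((2 * k) choose k) * n ^ k * W k))" by simp
  qed
  have "p_cong p (S ^ 2) (of_int ((\<Sum>k<p. W k * m ^ k) ^ 2))"
    using p_cong_power[OF p S S_int, of 2] by simp
  then have "p_cong p (S ^ 2) (\<Sum>k<p. of_nat ((2 * k) choose k) * y ^ k * of_int (W k))"
    using p_cong_of_int[OF p W_square_cong[OF p e]] T p_cong_trans[OF p] p_cong_sym[OF p]
    unfolding n_def by blast
  moreover have "y = x * (1 + 9 * x + 27 * x^2) / (1 - 27 * x^2)^2"
    by (simp add: y_def A_def D_def power_divide)
  ultimately show ?thesis unfolding S_def ivl by simp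
qed

end
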